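(* Let $(F_2,S^1,\Phi)$ be a dynamical system, where $F_2$ is the free group on two generators. If there is a minimal set $M\subset S^1$ for $\Phi$ which is not a Cantor set, then $\Phi$ does not have the shadowing property.
   Context: $F_2$ is the free group on generators $a,b$, with finite symmetric generator $S=\{a,a^{-1},b,b^{-1}\}$. $S^1$ is the circle with its usual metric $d$. A dynamical system $(G,X,\Phi)$ consists of a (discrete) group $G$, a metric space $X$ and a continuous map $\Phi:G\times X\to X$ with $\Phi(g_1,\Phi(g_2,x))=\Phi(g_1g_2,x)$ for all $g_1,g_2\in G$, $x\in X$, such that each $\Phi_g=\Phi(g,\cdot):X\to X$ is a homeomorphism. The orbit of $x$ is $O(x)=\{\Phi_g(x):g\in G\}$. A non-empty set $M\subset X$ is minimal if $\overline{O(x)}=M$ for every $x\in M$. For $\delta>0$, a family $\{x_g\}_{g\in G}\subset X$ is a $\delta$-pseudotrajectory if $d(\Phi_s(x_g),x_{sg})<\delta$ for all $g\in G$ and all $s\in S$. The action $\Phi$ has the shadowing property if for every $\varepsilon>0$ there exists $\delta>0$ such that for every $\delta$-pseudotrajectory $\{x_g\}$ there exists $y\in X$ with $d(x_g,\Phi_g(y))<\varepsilon$ for all $g\in G$. *)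

theory Defs
  imports "HOL-Analysis.Analysis" "HOL-Algebra.Group"
begin

section \<open>The free group as the group of reduced words\<close>

text \<open>The letter \<open>(x, True)\<close> stands for the generator \<open>x\<close>, and \<open>(x, False)\<close> for its
  formal inverse. The group elements are the reduced words themselves, and the product of two
  reduced words is the reduced form of their concatenation.\<close>

type_synonym 'a word = "('a \<times> bool) list"

definition inv_letter :: "'a \<times> bool \<Rightarrow> 'a \<times> bool" where
  "inv_letter p = (fst p, \<not> snd p)"

definition reduced_word :: "'a word \<Rightarrow> bool" where
  "reduced_word w \<longleftrightarrow> successively (\<lambda>p q. q \<noteq> inv_letter p) w"

fun cons_reduce :: "'a \<times> bool \<Rightarrow> 'a word \<Rightarrow> 'a word" where
  "cons_reduce p [] = [p]"
| "cons_reduce p (q # w) = (if q = inv_letter p then w else p # q # w)"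

definition mult_word :: "'a word \<Rightarrow> 'a word \<Rightarrow> 'a word" where
  "mult_word v w = foldr cons_reduce v w"

definition free_group :: "'a word monoid" where
  "free_group = \<lparr>carrier = {w. reduced_word w}, monoid.mult = mult_word, one = []\<rparr>"

lemma inv_letter_inv_letter [simp]: "inv_letter (inv_letter p) = p"
  by (simp add: inv_letter_def)

lemma reduced_Nil [simp]: "reduced_word []"
  by (simp add: reduced_word_def)

lemma reduced_Cons: "reduced_word (p # w) \<longleftrightarrow> reduced_word w \<and> (w = [] \<or> hd w \<noteq> inv_letter p)"
  by (cases w) (auto simp: reduced_word_def)

lemma reduced_cons_reduce: "reduced_word w \<Longrightarrow> reduced_word (cons_reduce p w)"
  by (cases w) (auto simp: reduced_Cons)

lemma cons_reduce_reduced: "reduced_word (p # w) \<Longrightarrow> cons_reduce p w = p # w"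
  by (cases w) (auto simp: reduced_Cons)

lemma cons_reduce_cancel: "reduced_word w \<Longrightarrow> cons_reduce p (cons_reduce (inv_letter p) w) = w"
  by (cases w) (auto simp: cons_reduce_reduced)

lemma reduced_mult_word: "reduced_word w \<Longrightarrow> reduced_word (mult_word v w)"
  by (induction v) (auto simp: mult_word_def reduced_cons_reduce)

lemma mult_word_Nil [simp]: "mult_word [] w = w"
  by (simp add: mult_word_def)

lemma mult_word_Cons [simp]: "mult_word (p # v) w = cons_reduce p (mult_word v w)"
  by (simp add: mult_word_def)

lemma mult_word_Nil_right: "reduced_word w \<Longrightarrow> mult_word w [] = w"
  by (induction w) (auto simp: reduced_Cons cons_reduce_reduced)

lemma mult_word_cons_reduce:
  assumes "reduced_word w"
  shows "mult_word (cons_reduce p v) w = cons_reduce p (mult_word v w)"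
proof (cases v)
  case (Cons q u)
  show ?thesis
  proof (cases "q = inv_letter p")
    case True
    then show ?thesis
      using Cons assms by (simp add: cons_reduce_cancel reduced_mult_word)
  qed (use Cons in simp)
qed simp

lemma mult_word_assoc:
  assumes "reduced_word w"
  shows "mult_word (mult_word u v) w = mult_word u (mult_word v w)"
  using assms by (induction u) (simp_all add: mult_word_cons_reduce)

lemma mult_word_append: "mult_word (u @ v) w = mult_word u (mult_word v w)"
  by (induction u) simp_all

lemma mult_word_inverse:
  "reduced_word w \<Longrightarrow> mult_word (map inv_letter (rev v)) (mult_word v w) = w"
proof (induction v arbitrary: w)
  case (Cons p v)
  have "cons_reduce (inv_letter p) (cons_reduce p (mult_word v w)) = mult_word v w"
    using cons_reduce_cancel[of "mult_word v w" "inv_letter p"] Cons.prems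
    by (simp add: reduced_mult_word)
  then show ?case
    using Cons by (simp add: mult_word_append)
qed simp

lemma group_free_group: "group free_group"
proof (rule groupI)
  fix w :: "'a word"
  assume w: "w \<in> carrier free_group"
  let ?v = "mult_word (map inv_letter (rev w)) []"
  have "mult_word ?v w = mult_word (map inv_letter (rev w)) (mult_word w [])"
    using w by (simp add: free_group_def mult_word_assoc mult_word_Nil_right)
  also have "\<dots> = []"
    by (simp add: mult_word_inverse)
  finally show "\<exists>v\<in>carrier free_group. v \<otimes>\<^bsub>free_group\<^esub> w = \<one>\<^bsub>free_group\<^esub>"
    by (intro bexI[of _ ?v]) (simp_all add: free_group_def reduced_mult_word)
qed (auto simp: free_group_def reduced_mult_word mult_word_assoc)


section \<open>The free group of rank two and its symmetric generating set\<close>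

datatype gen = Gen_a | Gen_b

abbreviation F2 :: "gen word monoid" where
  "F2 \<equiv> free_group"

definition a_F2 :: "gen word" where
  "a_F2 = [(Gen_a, True)]"

definition b_F2 :: "gen word" where
  "b_F2 = [(Gen_b, True)]"

definition S_F2 :: "gen word set" where
  "S_F2 = {a_F2, inv\<^bsub>F2\<^esub> a_F2, b_F2, inv\<^bsub>F2\<^esub> b_F2}"


section \<open>Group actions on metric spaces\<close>

text \<open>Metric spaces are given as subsets \<open>X\<close> of a type of class \<open>metric_space\<close>, with the
  restriction of \<open>dist\<close>.\<close>

definition dynamical_system ::
    "('g, 'r) monoid_scheme \<Rightarrow> 'x::metric_space set \<Rightarrow> ('g \<Rightarrow> 'x \<Rightarrow> 'x) \<Rightarrow> bool" where
  "dynamical_system G X \<Phi> \<longleftrightarrow>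
     group G \<and>
     continuous_map (prod_topology (discrete_topology (carrier G)) (top_of_set X))
       (top_of_set X) (\<lambda>(g, x). \<Phi> g x) \<and>
     (\<forall>g\<^sub>1\<in>carrier G. \<forall>g\<^sub>2\<in>carrier G. \<forall>x\<in>X. \<Phi> g\<^sub>1 (\<Phi> g\<^sub>2 x) = \<Phi> (g\<^sub>1 \<otimes>\<^bsub>G\<^esub> g\<^sub>2) x) \<and>
     (\<forall>g\<in>carrier G. homeomorphic_map (top_of_set X) (top_of_set X) (\<Phi> g))"

definition orbit ::
    "('g, 'r) monoid_scheme \<Rightarrow> ('g \<Rightarrow> 'x \<Rightarrow> 'x) \<Rightarrow> 'x \<Rightarrow> 'x set" where
  "orbit G \<Phi> x = (\<lambda>g. \<Phi> g x) ` carrier G"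

definition minimal_set ::
    "('g, 'r) monoid_scheme \<Rightarrow> 'x::metric_space set \<Rightarrow> ('g \<Rightarrow> 'x \<Rightarrow> 'x) \<Rightarrow> 'x set \<Rightarrow> bool" where
  "minimal_set G X \<Phi> M \<longleftrightarrow>
     M \<noteq> {} \<and> M \<subseteq> X \<and> (\<forall>x\<in>M. top_of_set X closure_of orbit G \<Phi> x = M)"

definition pseudotrajectory ::
    "('g, 'r) monoid_scheme \<Rightarrow> 'g set \<Rightarrow> 'x::metric_space set \<Rightarrow> ('g \<Rightarrow> 'x \<Rightarrow> 'x) \<Rightarrow>
     real \<Rightarrow> ('g \<Rightarrow> 'x) \<Rightarrow> bool" where
  "pseudotrajectory G S X \<Phi> \<delta> x \<longleftrightarrow>
     x \<in> carrier G \<rightarrow> X \<and>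
     (\<forall>g\<in>carrier G. \<forall>s\<in>S. dist (\<Phi> s (x g)) (x (s \<otimes>\<^bsub>G\<^esub> g)) < \<delta>)"

definition shadowing_property ::
    "('g, 'r) monoid_scheme \<Rightarrow> 'g set \<Rightarrow> 'x::metric_space set \<Rightarrow> ('g \<Rightarrow> 'x \<Rightarrow> 'x) \<Rightarrow> bool" where
  "shadowing_property G S X \<Phi> \<longleftrightarrow>
     (\<forall>\<epsilon>>0. \<exists>\<delta>>0. \<forall>x. pseudotrajectory G S X \<Phi> \<delta> x \<longrightarrow>
        (\<exists>y\<in>X. \<forall>g\<in>carrier G. dist (x g) (\<Phi> g y) < \<epsilon>))"


section \<open>The circle and Cantor sets\<close>

text \<open>The metric on the circle is the chordal one, inherited from the complex plane. It is
  uniformly equivalent to the arc-length metric, so the shadowing property is the same for both.\<close>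

abbreviation circle :: "complex set" where
  "circle \<equiv> sphere 0 1"

text \<open>A Cantor set is a homeomorphic copy of the Cantor space \<open>{0,1}\<^sup>\<nat>\<close>.\<close>

definition cantor_set :: "'x::topological_space set \<Rightarrow> bool" where
  "cantor_set C \<longleftrightarrow>
     top_of_set C homeomorphic_space
       product_topology (\<lambda>_::nat. discrete_topology (UNIV :: bool set)) UNIV"

end

theory Submission
  imports Defs
begin

text \<open>A minimal set that is not a Cantor set is finite or the whole circle. Since \<open>F2\<close> is free, the
  action lifts to the line, and so does shadowing. The Cayley graph is a tree, so a
  pseudotrajectory may follow different nearby orbits on its four branches at the identity; shadowing
  such families forces short intervals to stay short along all branches but one, unless their
  whole orbit stays short. The exceptional branch is incompatible with the dynamics, both when all orbits
  are dense and at points with finite orbit. Hence the action is equicontinuous, and then a slowly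
  drifting pseudotrajectory cannot be shadowed.\<close>

text \<open>One move drives both cases. A reduced word ending in \<open>s\<close> stays reduced when
  \<open>u \<noteq> inv_letter s\<close> is put behind it, so applying \<open>F u\<close> turns
  closeness on branch \<open>u\<close> into closeness on branch \<open>s\<close>. If a short
  interval is close on all branches but \<open>s\<close>, choose \<open>u\<close> different from
  \<open>s\<close> and its inverse, which takes two generators: the image interval is close on
  branch \<open>s\<close>. This is a contradiction as soon as \<open>s\<close> is also the
  exceptional letter of the image, so the difficulty is to make the two exceptional letters agree.
  With dense orbits, expansivity makes the letter constant along the line. At a point with finite
  orbit, a power of \<open>u\<close> returns to the same point and preserves orientation. The line
  is preferred to the circle because the maps are monotone there, so closeness passes from an
  interval to its subintervals.\<close>

section \<open>Recognising Cantor sets\<close>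

text \<open>Split \<open>C\<close> successively by the clopen sets \<open>U n\<close>, or by some other member of the family
  whenever \<open>U n\<close> does not cut the current piece; the itinerary of a point is the homeomorphism.\<close>

lemma cantor_set_if_clopen_separating_sequence:
  fixes C :: "'a::heine_borel set" and U :: "nat \<Rightarrow> 'a set"
  assumes "compact C" "C \<noteq> {}"
    and perfect: "\<And>x. x \<in> C \<Longrightarrow> x islimpt C"
    and clopen: "\<And>n. openin (top_of_set C) (C \<inter> U n)" "\<And>n. closedin (top_of_set C) (C \<inter> U n)"
    and separating: "\<And>x y. x \<in> C \<Longrightarrow> y \<in> C \<Longrightarrow> x \<noteq> y \<Longrightarrow> \<exists>n. x \<in> U n \<and> y \<notin> U n"
  shows "cantor_set C"
proof -
  let ?T = "top_of_set C"
  define cuts where "cuts n W \<longleftrightarrow> W \<inter> U n \<noteq> {} \<and> W - U n \<noteq> {}" for n W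
  define S where "S n W = (if cuts n W then U n else U (SOME k. cuts k W))" for n W
  define K where "K f n = rec_nat C (\<lambda>n W. if f n then W \<inter> S n W else W - S n W) n" for f n
  have K_0 [simp]: "K f 0 = C" for f
    by (simp add: K_def)
  have K_Suc: "K f (Suc n) = (if f n then K f n \<inter> S n (K f n) else K f n - S n (K f n))" for f n
    by (simp add: K_def)
  have K_cong: "K f n = K f' n" if "\<And>i. i < n \<Longrightarrow> f i = f' i" for f f' n
    using that by (induction n) (auto simp: K_Suc)
  have sub: "K f n \<subseteq> C" for f n
    by (induction n) (auto simp: K_Suc)
  have S_U: "\<exists>k. S n W = U k" for n W
    by (auto simp: S_def)
  have clopen_K: "openin ?T (K f n) \<and> closedin ?T (K f n)" for f n
  proof (induction n)
    case (Suc n)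
    obtain k where k: "S n (K f n) = U k"
      using S_U by blast
    have "K f n \<inter> U k = K f n \<inter> (C \<inter> U k)" "K f n - U k = K f n - (C \<inter> U k)"
      using sub by blast+
    then show ?case
      using Suc clopen[of k] by (auto simp: K_Suc k openin_diff closedin_diff)
  qed simp
  have cut: "cuts n W \<Longrightarrow> S n W = U n" for n W
    by (simp add: S_def)
  \<comment> \<open>Perfectness puts two points into \<open>W\<close>; a separating set tells them
    apart, so the choice in \<open>S\<close> succeeds and both halves are nonempty.\<close>
  have S_cuts: "W \<inter> S n W \<noteq> {} \<and> W - S n W \<noteq> {}" if W: "openin ?T W" "W \<noteq> {}" for n W
  proof -
    obtain x where x: "x \<in> W" "x \<in> C"
      using W openin_imp_subset[OF W(1)] by blast
    obtain V where V: "open V" "W = C \<inter> V"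
      using W(1) unfolding openin_open by blast
    obtain y where "y \<in> C" "y \<in> V" "y \<noteq> x"
      using perfect[OF x(2)] V x(1) unfolding islimpt_def by blast
    then obtain k where "cuts k W"
      using separating[of x y] x V by (auto simp: cuts_def)
    then have "cuts (SOME k. cuts k W) W"
      by (rule someI)
    then show ?thesis
      by (auto simp: S_def cuts_def)
  qed
  have K_ne: "K f n \<noteq> {}" for f n
  proof (induction n)
    case (Suc n)
    then show ?case
      using S_cuts[of "K f n" n] clopen_K by (simp add: K_Suc)
  qed (simp add: assms)
  \<comment> \<open>Defining \<open>\<phi>\<close> through \<open>K (\<phi> x)\<close> would be
    circular. \<open>J x\<close> follows the point directly and afterwards turns out to be
    \<open>K (\<phi> x)\<close>.\<close>
  define J where
    "J x n = rec_nat C (\<lambda>n W. if x \<in> S n W then W \<inter> S n W else W - S n W) n" for x n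
  define \<phi> where "\<phi> x n \<longleftrightarrow> x \<in> S n (J x n)" for x n
  have "J x n = K (\<phi> x) n" for x n
  proof (induction n)
    case (Suc n)
    have "J x (Suc n) = (if \<phi> x n then J x n \<inter> S n (J x n) else J x n - S n (J x n))"
      by (simp add: J_def \<phi>_def)
    then show ?case
      by (simp only: K_Suc Suc.IH)
  qed (simp add: J_def)
  then have \<phi>: "\<phi> x n \<longleftrightarrow> x \<in> S n (K (\<phi> x) n)" for x n
    by (simp add: \<phi>_def)
  have in_K: "x \<in> K (\<phi> x) n" if "x \<in> C" for x n
  proof (induction n)
    case (Suc n)
    then show ?case
      using \<phi>[of x n] unfolding K_Suc by (cases "\<phi> x n") simp_all
  qed (simp add: that)
  have \<phi>_unique: "\<phi> x i = f i" if "x \<in> K f n" "i < n" for x f n i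
    using that
  proof (induction n arbitrary: i)
    case (Suc n)
    then have "x \<in> K f n" by (auto simp: K_Suc split: if_splits)
    then have "\<phi> x j = f j" if "j < n" for j
      using Suc.IH that by blast
    then have "K (\<phi> x) n = K f n"
      by (rule K_cong)
    then have "\<phi> x n = f n"
      using Suc.prems(1) \<phi>[of x n] unfolding K_Suc by (cases "f n") simp_all
    then show ?case
      using Suc.IH[OF \<open>x \<in> K f n\<close>] Suc.prems(2) less_SucE by blast
  qed simp
  let ?P = "product_topology (\<lambda>_::nat. discrete_topology (UNIV :: bool set)) UNIV"
  have "homeomorphic_map ?T ?P \<phi>"
  proof (rule continuous_imp_homeomorphic_map)
    show "compact_space ?T"
      using assms(1) by (simp add: compact_space_subtopology)
    show "Hausdorff_space ?P"
      by (simp add: Hausdorff_space_product_topology)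
    show "continuous_map ?T ?P \<phi>"
      unfolding continuous_map_componentwise_UNIV
    proof
      fix n
      show "continuous_map ?T (discrete_topology UNIV) (\<lambda>x. \<phi> x n)"
        unfolding continuous_map_def
      proof (intro conjI allI impI)
        fix B :: "bool set"
        show "openin ?T {x \<in> topspace ?T. \<phi> x n \<in> B}"
        proof (subst openin_subopen, intro ballI)
          fix x assume x: "x \<in> {x \<in> topspace ?T. \<phi> x n \<in> B}"
          then have "K (\<phi> x) (Suc n) \<subseteq> {x \<in> topspace ?T. \<phi> x n \<in> B}"
            using \<phi>_unique[of _ "\<phi> x" "Suc n" n] sub by fastforce
          then show "\<exists>T. openin ?T T \<and> x \<in> T \<and> T \<subseteq> {x \<in> topspace ?T. \<phi> x n \<in> B}"
            using clopen_K[of "\<phi> x" "Suc n"] in_K[of x "Suc n"] x by auto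
        qed
      qed simp
    qed
    \<comment> \<open>Here the priority of \<open>U n\<close> at stage \<open>n\<close> pays off:
      points with equal itineraries share every piece, so a \<open>U n\<close> separating them cuts
      their common piece and splits them.\<close>
    show "inj_on \<phi> (topspace ?T)"
    proof (rule inj_onI, rule ccontr)
      fix x y assume xy: "x \<in> topspace ?T" "y \<in> topspace ?T" "\<phi> x = \<phi> y" "x \<noteq> y"
      then obtain n where n: "x \<in> U n" "y \<notin> U n"
        using separating by auto
      have "x \<in> K (\<phi> x) n" "y \<in> K (\<phi> x) n"
        using in_K[of x n] in_K[of y n] xy by simp_all
      then have "S n (K (\<phi> x) n) = U n"
        using n by (intro cut) (auto simp: cuts_def)
      then show False
        using \<phi>[of x n] \<phi>[of y n] xy(3) n by simp
    qed
    show "\<phi> ` topspace ?T = topspace ?P"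
    proof -
      have "f \<in> \<phi> ` C" for f
      proof -
        have "(\<Inter>n. K f n) \<noteq> {}"
        proof (rule compact_nest)
          show "compact (K f n)" for n
            using clopen_K[of f n] assms(1) by (metis closedin_compact)
          show "K f n \<noteq> {}" for n
            by (rule K_ne)
          show "m \<le> n \<Longrightarrow> K f n \<subseteq> K f m" for m n
            by (induction rule: dec_induct) (auto simp: K_Suc)
        qed
        then obtain x where x: "\<And>n. x \<in> K f n" by blast
        then have "\<phi> x = f"
          using \<phi>_unique[OF x lessI] by blast
        then show ?thesis
          using x[of 0] by auto
      qed
      then show ?thesis by auto
    qed
  qed
  then show ?thesis
    unfolding cantor_set_def by (rule homeomorphic_map_imp_homeomorphic_space)
qed

section \<open>Free group actions on the line\<close>

instance gen :: finite
proof
  have "(UNIV :: gen set) = {Gen_a, Gen_b}"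
    using gen.exhaust by auto
  then show "finite (UNIV :: gen set)"
    by (metis finite.emptyI finite.insertI)
qed

lemma inv_letter_neq [simp]: "inv_letter l \<noteq> l" "l \<noteq> inv_letter l"
  by (auto simp: inv_letter_def prod_eq_iff)

text \<open>Rank two is used here: \<open>u\<close> is taken over the other generator.\<close>

lemma exists_other_letter: "\<exists>u :: gen \<times> bool. u \<noteq> s \<and> u \<noteq> inv_letter s \<and> s \<noteq> inv_letter u"
proof -
  obtain x where "x \<noteq> fst s"
    by (metis gen.distinct(1))
  then show ?thesis
    by (intro exI[of _ "(x, True)"]) (auto simp: inv_letter_def)
qed

definition inv_word :: "'a word \<Rightarrow> 'a word" where
  "inv_word w = map inv_letter (rev w)"

lemma reduced_append_replicate:
  assumes "reduced_word w" "w = [] \<or> last w \<noteq> inv_letter u"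
  shows "reduced_word (w @ replicate m u)"
proof -
  have "successively (\<lambda>p q. q \<noteq> inv_letter p) (replicate m u)"
    by (induction m) (auto simp: successively_Cons)
  moreover have "u \<noteq> inv_letter (last w)" if "w \<noteq> []"
    using assms that by (metis inv_letter_inv_letter)
  ultimately show ?thesis
    using assms by (auto simp: reduced_word_def successively_append_iff)
qed

section \<open>The covering map \<open>cis\<close> and uniqueness of lifts\<close>

lemma cis_eq_cis_iff: "cis x = cis y \<longleftrightarrow> (\<exists>k::int. x = y + 2 * pi * k)"
proof -
  have "cis x = cis y \<longleftrightarrow> sin x = sin y \<and> cos x = cos y"
    by (auto simp: complex_eq_iff)
  then show ?thesis
    by (simp add: sin_cos_eq_iff)
qed

lemma cis_translate [simp]: "cis (x + 2 * pi * of_int k) = cis x"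
  by (auto simp: cis_eq_cis_iff)

lemma cis_Arg_circle: "z \<in> sphere 0 1 \<Longrightarrow> cis (Arg z) = z"
  by (subst cis_Arg) (auto simp: sgn_div_norm)

lemma translate_into_period: "\<exists>k::int. a \<le> x + 2 * pi * k \<and> x + 2 * pi * k < a + 2 * pi"
proof (intro exI conjI)
  let ?y = "(x - a) / (2 * pi)"
  have "of_int \<lfloor>?y\<rfloor> * (2 * pi) \<le> ?y * (2 * pi)" "?y * (2 * pi) < (of_int \<lfloor>?y\<rfloor> + 1) * (2 * pi)"
    by (intro mult_right_mono mult_strict_right_mono of_int_floor_le real_of_int_floor_add_one_gt; simp)+
  moreover have "?y * (2 * pi) = x - a"
    by simp
  ultimately show "a \<le> x + 2 * pi * of_int (- \<lfloor>?y\<rfloor>)" "x + 2 * pi * of_int (- \<lfloor>?y\<rfloor>) < a + 2 * pi"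
    by (simp_all only: of_int_minus, simp_all add: mult.commute distrib_left)
qed

text \<open>The difference is continuous with values in the multiples of \<open>2 * pi\<close>,
  hence constant: two lifts of one circle map differ by a deck translation.\<close>

lemma cis_eq_imp_constant_difference:
  assumes "continuous_on UNIV f" "continuous_on UNIV g" "\<And>x::real. cis (f x) = cis (g x)"
  obtains k :: int where "\<And>x. f x = g x + 2 * pi * k"
proof -
  have int: "\<exists>k::int. f x - g x = 2 * pi * k" for x
    using assms(3)[of x] by (force simp: cis_eq_cis_iff)
  have "(\<lambda>x. f x - g x) constant_on UNIV"
  proof (rule continuous_discrete_range_constant)
    show "continuous_on UNIV (\<lambda>x. f x - g x)"
      by (intro continuous_intros assms)
    show "\<exists>e>0. \<forall>y. y \<in> UNIV \<and> f y - g y \<noteq> f x - g x \<longrightarrow> e \<le> norm (f y - g y - (f x - g x))" for x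
    proof (intro exI[of _ "2 * pi"] conjI allI impI)
      fix y assume "y \<in> UNIV \<and> f y - g y \<noteq> f x - g x"
      moreover obtain j k :: int where "f x - g x = 2 * pi * j" "f y - g y = 2 * pi * k"
        using int by blast
      ultimately have "f y - g y - (f x - g x) = 2 * pi * of_int (k - j)" "k \<noteq> j"
        by (auto simp: algebra_simps)
      moreover from this have "1 \<le> \<bar>real_of_int (k - j)\<bar>"
        by linarith
      ultimately show "2 * pi \<le> norm (f y - g y - (f x - g x))"
        by (simp add: abs_mult)
    qed simp
  qed simp
  then show thesis
    using int that unfolding constant_on_def by (metis UNIV_I add.commute diff_eq_eq)
qed

text \<open>A letter acts by \<open>F l\<close>, and a word by composition with the last letter acting first. The
  branches of the Cayley tree at the identity are therefore indexed by the \<^emph>\<open>last\<close> letter.\<close>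

locale line_action =
  fixes F :: "gen \<times> bool \<Rightarrow> real \<Rightarrow> real"
  assumes F_cancel [simp]: "F l (F (inv_letter l) x) = x"
    and F_continuous: "continuous_on UNIV (F l)"
    and F_cis_cong: "cis x = cis y \<Longrightarrow> cis (F l x) = cis (F l y)"
begin

definition act :: "gen word \<Rightarrow> real \<Rightarrow> real" where
  "act = foldr F"

lemma act_Nil [simp]: "act [] x = x"
  by (simp add: act_def)

lemma act_Cons [simp]: "act (l # w) x = F l (act w x)"
  by (simp add: act_def)

lemma act_append: "act (v @ w) x = act v (act w x)"
  by (induction v) simp_all

lemma F_cancel' [simp]: "F (inv_letter l) (F l x) = x"
  using F_cancel[of "inv_letter l" x] by simp

lemma act_cons_reduce [simp]: "act (cons_reduce l w) x = F l (act w x)"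
  by (cases w) auto

lemma act_mult_word: "act (mult_word v w) x = act v (act w x)"
  by (induction v) simp_all

lemma act_inv_word [simp]: "act (inv_word w) (act w x) = x" "act w (act (inv_word w) x) = x"
proof -
  show "act (inv_word w) (act w x) = x" for w x
    by (induction w arbitrary: x) (simp_all add: inv_word_def act_append)
  from this[of "inv_word w" x] show "act w (act (inv_word w) x) = x"
    by (simp add: inv_word_def rev_map comp_def)
qed

lemma act_reduced_word: "\<exists>v. reduced_word v \<and> act v = act w"
  by (intro exI[of _ "mult_word w []"]) (auto simp: reduced_mult_word act_mult_word)

lemma act_continuous: "continuous_on A (act w)"
proof -
  have "continuous_on UNIV (act w)"
  proof (induction w)
    case (Cons l w)
    then have "continuous_on UNIV (\<lambda>x. F l (act w x))"
      using continuous_on_compose2[OF F_continuous] by blast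
    then show ?case
      by (simp add: act_def comp_def)
  qed (simp add: act_def)
  then show ?thesis
    using continuous_on_subset by blast
qed

lemma cis_act_cong: "cis x = cis y \<Longrightarrow> cis (act w x) = cis (act w y)"
  by (induction w) (auto intro: F_cis_cong)

text \<open>Translating the argument gives another lift of the same circle map, so values change by
  a constant. This constant need not be \<open>2 * pi * k\<close>, as \<open>act w\<close> may
  reverse orientation; it cancels in differences.\<close>

lemma act_translate_diff:
  "act w (x + 2 * pi * of_int k) - act w (y + 2 * pi * of_int k) = act w x - act w y"
proof -
  have "cis (act w (x + 2 * pi * of_int k)) = cis (act w x)" for x
    by (rule cis_act_cong) (auto simp: cis_eq_cis_iff)
  moreover have "continuous_on UNIV (\<lambda>x. act w (x + 2 * pi * of_int k))"
    by (intro continuous_on_compose2[OF act_continuous[of UNIV]] continuous_intros) auto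
  ultimately obtain j :: int where "\<And>x. act w (x + 2 * pi * of_int k) = act w x + 2 * pi * j"
    using cis_eq_imp_constant_difference[OF _ act_continuous] by metis
  then show ?thesis by simp
qed

lemma act_uniformly_continuous:
  assumes "\<epsilon> > 0"
  shows "\<exists>\<delta>>0. \<forall>x y. \<bar>x - y\<bar> < \<delta> \<longrightarrow> \<bar>act w x - act w y\<bar> < \<epsilon>"
proof -
  \<comment> \<open>A period is enlarged by 1 on both sides, so that \<open>y\<close> at distance
    below 1 moves into the interval together with \<open>x\<close>.\<close>
  have "uniformly_continuous_on {- 1..2 * pi + 1} (act w)"
    by (intro compact_uniformly_continuous act_continuous) simp
  then obtain \<delta> where \<delta>: "\<delta> > 0" "\<And>x y. x \<in> {- 1..2 * pi + 1} \<Longrightarrow> y \<in> {- 1..2 * pi + 1} \<Longrightarrow>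
      \<bar>x - y\<bar> < \<delta> \<Longrightarrow> \<bar>act w x - act w y\<bar> < \<epsilon>"
    using assms unfolding uniformly_continuous_on_def dist_real_def by metis
  have "\<bar>act w x - act w y\<bar> < \<epsilon>" if xy: "\<bar>x - y\<bar> < min \<delta> 1" for x y
  proof -
    obtain k :: int where k: "0 \<le> x + 2 * pi * k" "x + 2 * pi * k < 2 * pi"
      using translate_into_period[of 0 x] by auto
    have "x + 2 * pi * of_int k \<in> {- 1..2 * pi + 1}" "y + 2 * pi * of_int k \<in> {- 1..2 * pi + 1}"
      using k xy by auto
    from \<delta>(2)[OF this] have "\<bar>act w (x + 2 * pi * of_int k) - act w (y + 2 * pi * of_int k)\<bar> < \<epsilon>"
      using xy by simp
    then show ?thesis
      by (simp only: act_translate_diff)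
  qed
  then show ?thesis
    using \<delta>(1) by (intro exI[of _ "min \<delta> 1"]) auto
qed

lemma act_inj: "inj (act w)"
  by (metis act_inv_word(1) injI)

lemma act_monotone: "strict_mono (act w) \<or> (\<forall>x y. x < y \<longrightarrow> act w y < act w x)"
proof -
  have "strict_mono_on UNIV (act w) \<or> strict_antimono_on UNIV (act w)"
    using injective_eq_monotone_map[of UNIV "act w"] act_inj act_continuous by simp
  then show ?thesis
    by (auto simp: monotone_on_def)
qed

lemma act_between_le:
  assumes "p \<le> p'" "p' \<le> q'" "q' \<le> q"
  shows "\<bar>act w p' - act w q'\<bar> \<le> \<bar>act w p - act w q\<bar>"
  using act_monotone[of w]
proof
  assume "strict_mono (act w)"
  then have "act w p \<le> act w p'" "act w p' \<le> act w q'" "act w q' \<le> act w q"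
    using assms by (simp_all add: strict_mono_less_eq)
  then show ?thesis by simp
next
  assume "\<forall>x y. x < y \<longrightarrow> act w y < act w x"
  then have "act w p' \<le> act w p" "act w q' \<le> act w p'" "act w q \<le> act w q'"
    using assms by (metis order.strict_iff_order order.refl)+
  then show ?thesis by simp
qed

section \<open>Shadowing on the line and closeness along branches\<close>

definition line_pseudotrajectory :: "real \<Rightarrow> (gen word \<Rightarrow> real) \<Rightarrow> bool" where
  "line_pseudotrajectory \<delta> t \<longleftrightarrow>
     (\<forall>g l. reduced_word g \<longrightarrow> \<bar>F l (t g) - t (cons_reduce l g)\<bar> < \<delta>)"

definition line_shadowing :: bool where
  "line_shadowing \<longleftrightarrow> (\<forall>\<epsilon>>0. \<exists>\<delta>>0. \<forall>t. line_pseudotrajectory \<delta> t \<longrightarrow>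
     (\<exists>y. \<forall>g. reduced_word g \<longrightarrow> \<bar>t g - act g y\<bar> < \<epsilon>))"

definition branch_close :: "real \<Rightarrow> (gen \<times> bool) set \<Rightarrow> real \<Rightarrow> real \<Rightarrow> bool" where
  "branch_close \<epsilon> A p q \<longleftrightarrow>
     (\<forall>g. reduced_word g \<longrightarrow> g \<noteq> [] \<longrightarrow> last g \<in> A \<longrightarrow> \<bar>act g p - act g q\<bar> < \<epsilon>)"

text \<open>All words are allowed, reduced or not, which makes invariance under \<open>act\<close>
  immediate; \<open>act_reduced_word\<close> leads back to reduced words.\<close>

definition orbit_close :: "real \<Rightarrow> real \<Rightarrow> real \<Rightarrow> bool" where
  "orbit_close \<epsilon> p q \<longleftrightarrow> (\<forall>w. \<bar>act w p - act w q\<bar> < \<epsilon>)"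

lemma orbit_close_iff: "orbit_close \<epsilon> p q \<longleftrightarrow> \<bar>p - q\<bar> < \<epsilon> \<and> branch_close \<epsilon> UNIV p q"
proof
  assume "orbit_close \<epsilon> p q"
  then show "\<bar>p - q\<bar> < \<epsilon> \<and> branch_close \<epsilon> UNIV p q"
    unfolding orbit_close_def branch_close_def by (metis act_Nil)
next
  assume *: "\<bar>p - q\<bar> < \<epsilon> \<and> branch_close \<epsilon> UNIV p q"
  show "orbit_close \<epsilon> p q"
    unfolding orbit_close_def
  proof
    fix w
    obtain v where "reduced_word v" "act v = act w"
      using act_reduced_word by blast
    then show "\<bar>act w p - act w q\<bar> < \<epsilon>"
      using * unfolding branch_close_def by (metis UNIV_I act_Nil)
  qed
qed

lemma branch_close_Un: "branch_close \<epsilon> (A \<union> B) p q \<longleftrightarrow> branch_close \<epsilon> A p q \<and> branch_close \<epsilon> B p q"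
  unfolding branch_close_def by blast

lemma branch_close_mono: "branch_close \<epsilon> A p q \<Longrightarrow> B \<subseteq> A \<Longrightarrow> branch_close \<epsilon> B p q"
  unfolding branch_close_def by blast

lemma branch_close_sym: "branch_close \<epsilon> A p q \<longleftrightarrow> branch_close \<epsilon> A q p"
  unfolding branch_close_def by (simp add: abs_minus_commute)

lemma branch_close_subinterval:
  assumes "branch_close \<epsilon> A p q" "p \<le> p'" "p' \<le> q'" "q' \<le> q"
  shows "branch_close \<epsilon> A p' q'"
  using assms act_between_le[OF assms(2-4)] unfolding branch_close_def by (meson order.strict_trans1)

lemma branch_close_translate:
  "branch_close \<epsilon> A (p + 2 * pi * of_int k) (q + 2 * pi * of_int k) \<longleftrightarrow> branch_close \<epsilon> A p q"
  unfolding branch_close_def by (simp add: act_translate_diff)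

lemma orbit_close_translate:
  "orbit_close \<epsilon> (p + 2 * pi * of_int k) (q + 2 * pi * of_int k) \<longleftrightarrow> orbit_close \<epsilon> p q"
  unfolding orbit_close_def by (simp add: act_translate_diff)

lemma orbit_close_subinterval:
  assumes "orbit_close \<epsilon> p q" "p \<le> p'" "p' \<le> q'" "q' \<le> q"
  shows "orbit_close \<epsilon> p' q'"
  using assms act_between_le[OF assms(2-4)] unfolding orbit_close_def by (meson order.strict_trans1)

lemma orbit_close_act: "orbit_close \<epsilon> (act w p) (act w q) \<longleftrightarrow> orbit_close \<epsilon> p q"
proof
  show "orbit_close \<epsilon> p q \<Longrightarrow> orbit_close \<epsilon> (act w p) (act w q)" for p q w
    unfolding orbit_close_def by (metis act_append)
  from this[of "act w p" "act w q" "inv_word w"]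
  show "orbit_close \<epsilon> (act w p) (act w q) \<Longrightarrow> orbit_close \<epsilon> p q"
    by simp
qed

text \<open>Appending copies of \<open>u\<close> to a reduced word ending in \<open>s\<close> causes
  no cancellation and gives a reduced word ending in \<open>u\<close>, to which the hypothesis
  applies.\<close>

lemma branch_close_act_replicate:
  assumes "branch_close \<epsilon> {u} p q" "s \<noteq> inv_letter u" "0 < m"
  shows "branch_close \<epsilon> {s} (act (replicate m u) p) (act (replicate m u) q)"
  unfolding branch_close_def
proof (intro allI impI)
  fix g :: "gen word"
  assume "reduced_word g" "g \<noteq> []" "last g \<in> {s}"
  then have "reduced_word (g @ replicate m u)"
    using assms(2) by (intro reduced_append_replicate) auto
  moreover have "g @ replicate m u \<noteq> []" "last (g @ replicate m u) \<in> {u}"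
    using assms(3) by (auto simp: last_replicate last_append)
  ultimately show "\<bar>act g (act (replicate m u) p) - act g (act (replicate m u) q)\<bar> < \<epsilon>"
    using assms(1) unfolding branch_close_def by (metis act_append)
qed

lemma F_unif_finite: "\<epsilon> > 0 \<Longrightarrow> \<exists>\<delta>>0. \<forall>l x y. \<bar>x - y\<bar> < \<delta> \<longrightarrow> \<bar>F l x - F l y\<bar> < \<epsilon>"
proof -
  assume "\<epsilon> > 0"
  then have "\<forall>l. \<exists>\<delta>>0. \<forall>x y. \<bar>x - y\<bar> < \<delta> \<longrightarrow> \<bar>F l x - F l y\<bar> < \<epsilon>"
    using act_uniformly_continuous[of \<epsilon> "[l]" for l] by simp
  then obtain d where d: "\<And>l. d l > 0" "\<And>l x y. \<bar>x - y\<bar> < d l \<Longrightarrow> \<bar>F l x - F l y\<bar> < \<epsilon>"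
    by metis
  show ?thesis
    by (rule exI[of _ "Min (range d)"]) (auto simp: d)
qed

text \<open>The Cayley graph is a tree, so one may follow the orbit of \<open>p\<close> on the branches in \<open>A\<close> and the
  orbit of \<open>q\<close> on the others; the only error is made at the identity. Monotonicity moves the
  shadowing point into the interval.\<close>

lemma shadowing_imp_splitting:
  assumes "line_shadowing" "\<epsilon> > 0"
  obtains \<delta> where "\<delta> > 0" "\<delta> \<le> \<epsilon>"
    "\<And>p q A. p \<le> q \<Longrightarrow> q < p + \<delta> \<Longrightarrow>
       \<exists>z. p \<le> z \<and> z \<le> q \<and> branch_close \<epsilon> A p z \<and> branch_close \<epsilon> (- A) z q"
proof -
  obtain \<eta> where \<eta>: "\<eta> > 0" "\<And>t. line_pseudotrajectory \<eta> t
      \<Longrightarrow> \<exists>y. \<forall>g. reduced_word g \<longrightarrow> \<bar>t g - act g y\<bar> < \<epsilon>"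
    using assms unfolding line_shadowing_def by blast
  obtain \<delta> where \<delta>: "\<delta> > 0" "\<And>l x y. \<bar>x - y\<bar> < \<delta> \<Longrightarrow> \<bar>F l x - F l y\<bar> < \<eta>"
    using F_unif_finite[OF \<eta>(1)] by blast
  show thesis
  \<comment> \<open>\<open>\<delta>\<close> controls the error on edges leaving the identity,
    \<open>\<eta>\<close> that on edges returning to it, which is at most
    \<open>q - p\<close>.\<close>
  proof (rule that[of "min \<delta> (min \<eta> \<epsilon>)"])
    fix p q A
    assume pq: "p \<le> q" "q < p + min \<delta> (min \<eta> \<epsilon>)"
    define t where
      "t g = (if g = [] then p else if last g \<in> A then act g p else act g q)" for g
    have "\<bar>F l (t g) - t (cons_reduce l g)\<bar> < \<eta>" if g: "reduced_word g" for g l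
    proof (cases "g = [] \<or> cons_reduce l g = []")
      case True
      then have "g = [] \<or> g = [inv_letter l]"
        using g by (cases g) (auto split: if_splits)
      then show ?thesis
        using pq \<eta>(1) \<delta>(2)[of p q l] by (auto simp: t_def)
    next
      case False
      \<comment> \<open>Away from the identity, multiplication on the left keeps the last letter,
        hence the branch, and the error is zero.\<close>
      then have "last (cons_reduce l g) = last g"
        using g by (cases g) auto
      then show ?thesis
        using False \<eta>(1) by (auto simp: t_def)
    qed
    then have "line_pseudotrajectory \<eta> t"
      by (simp add: line_pseudotrajectory_def)
    then obtain y where y: "\<And>g. reduced_word g \<Longrightarrow> \<bar>t g - act g y\<bar> < \<epsilon>"
      using \<eta>(2) by blast
    have yA: "branch_close \<epsilon> A p y" "branch_close \<epsilon> (- A) y q"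
      using y unfolding branch_close_def t_def by (metis, metis ComplD abs_minus_commute)
    \<comment> \<open>If \<open>y\<close> lies outside, \<open>z\<close> is the nearer endpoint: one
      condition becomes trivial, the other is inherited from a larger interval.\<close>
    define z where "z = max p (min y q)"
    have "branch_close \<epsilon> A p z \<and> branch_close \<epsilon> (- A) z q"
    proof -
      consider "y < p" | "p \<le> y" "y \<le> q" | "q < y" by linarith
      then show ?thesis
      proof cases
        case 1
        then have "z = p" using pq by (simp add: z_def)
        then show ?thesis
          using 1 yA(2) pq assms(2) branch_close_subinterval[OF yA(2), of p q]
          by (simp add: branch_close_def)
      next
        case 2
        then show ?thesis using yA by (simp add: z_def)
      next
        case 3
        then have "z = q" using pq by (simp add: z_def)
        then show ?thesis
          using 3 pq assms(2) branch_close_subinterval[OF yA(1), of p q]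
          by (simp add: branch_close_def)
      qed
    qed
    then show "\<exists>z. p \<le> z \<and> z \<le> q \<and> branch_close \<epsilon> A p z \<and> branch_close \<epsilon> (- A) z q"
      using pq by (intro exI[of _ z]) (auto simp: z_def)
  qed (use \<delta> \<eta> assms in auto)
qed

text \<open>If each branch were close on some interval to the right of \<open>p\<close>, the
  shortest of these would have a small orbit. So some branch \<open>s\<close> fails at once, and
  splitting with \<open>A = {s}\<close> forces \<open>z = p\<close>, which leaves closeness on the
  other branches up to \<open>q\<close>.\<close>

lemma expanding_branch:
  assumes split: "\<And>A. \<exists>z. p \<le> z \<and> z \<le> q \<and> branch_close \<epsilon> A p z \<and> branch_close \<epsilon> (- A) z q"
    and pq: "p < q" "q < p + \<epsilon>"
    and exp: "\<And>z. p < z \<Longrightarrow> \<not> orbit_close \<epsilon> p z"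
  obtains s where "branch_close \<epsilon> (- {s}) p q" "\<And>z. p < z \<Longrightarrow> \<not> branch_close \<epsilon> {s} p z"
proof -
  have "\<exists>s. \<forall>z>p. \<not> branch_close \<epsilon> {s} p z"
  proof (rule ccontr)
    assume "\<not> ?thesis"
    then obtain f where f: "\<And>s. f s > p" "\<And>s. branch_close \<epsilon> {s} p (f s)"
      by metis
    define z where "z = min q (Min (range f))"
    have z: "p < z" "z \<le> q" "\<And>s. z \<le> f s"
      using f pq by (auto simp: z_def min.coboundedI2)
    have "branch_close \<epsilon> {s} p z" for s
      using branch_close_subinterval[OF f(2)[of s], of p z] z by simp
    then have "branch_close \<epsilon> UNIV p z"
      unfolding branch_close_def by blast
    then have "orbit_close \<epsilon> p z"
      using z pq by (simp add: orbit_close_iff)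
    then show False
      using exp z by blast
  qed
  then obtain s where s: "\<And>z. p < z \<Longrightarrow> \<not> branch_close \<epsilon> {s} p z"
    by blast
  obtain z where "p \<le> z" "z \<le> q" "branch_close \<epsilon> {s} p z" "branch_close \<epsilon> (- {s}) z q"
    using split by blast
  then have "branch_close \<epsilon> (- {s}) p q"
    using s[of z] by (cases "z = p") auto
  then show thesis
    using that s by blast
qed

text \<open>If all the orbit maps were equicontinuous, the pseudotrajectory that drifts away with the word
  length could not be shadowed.\<close>

lemma equicontinuous_not_shadowing:
  assumes equi: "\<And>\<epsilon>. \<epsilon> > 0 \<Longrightarrow> \<exists>\<delta>>0. \<forall>p q. \<bar>p - q\<bar> < \<delta> \<longrightarrow> orbit_close \<epsilon> p q"
  shows "\<not> line_shadowing"
proof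
  assume "line_shadowing"
  obtain \<epsilon> where \<epsilon>: "\<epsilon> > 0" "\<And>p q. \<bar>p - q\<bar> < \<epsilon> \<Longrightarrow> orbit_close 1 p q"
    using equi[of 1] by auto
  obtain \<delta> where \<delta>: "\<delta> > 0" "\<And>t. line_pseudotrajectory \<delta> t
      \<Longrightarrow> \<exists>y. \<forall>g. reduced_word g \<longrightarrow> \<bar>t g - act g y\<bar> < \<epsilon>"
    using \<open>line_shadowing\<close> \<epsilon>(1) unfolding line_shadowing_def by blast
  obtain \<eta> where \<eta>: "\<eta> > 0" "\<And>p q. \<bar>p - q\<bar> < \<eta> \<Longrightarrow> orbit_close \<delta> p q"
    using equi[OF \<delta>(1)] by auto
  define \<theta> where "\<theta> = \<eta> / 2"
  \<comment> \<open>Lengths of neighbouring words differ by at most one, so the starting point moves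
    by at most \<open>\<theta> < \<eta>\<close> per edge.\<close>
  define t where "t g = act g (\<theta> * length g)" for g
  have "\<bar>F l (t g) - t (cons_reduce l g)\<bar> < \<delta>" if "reduced_word g" for g l
  proof -
    have "\<bar>real (length g) - real (length (cons_reduce l g))\<bar> \<le> 1"
      by (cases g) auto
    then have "\<bar>\<theta> * length g - \<theta> * length (cons_reduce l g)\<bar> \<le> \<theta>"
      using \<eta>(1) by (simp only: right_diff_distrib[symmetric] abs_mult) (simp add: \<theta>_def mult_left_le)
    then have "orbit_close \<delta> (\<theta> * length g) (\<theta> * length (cons_reduce l g))"
      using \<eta> by (intro \<eta>(2)) (simp add: \<theta>_def)
    then have "\<bar>act (cons_reduce l g) (\<theta> * length g) - t (cons_reduce l g)\<bar> < \<delta>"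
      unfolding orbit_close_def t_def by blast
    then show ?thesis by (simp add: t_def)
  qed
  then have "line_pseudotrajectory \<delta> t"
    by (simp add: line_pseudotrajectory_def)
  then obtain y where y: "\<And>g. reduced_word g \<Longrightarrow> \<bar>t g - act g y\<bar> < \<epsilon>"
    using \<delta>(2) by blast
  \<comment> \<open>Equicontinuity carries the shadowing estimate at \<open>g\<close> back to the
    starting points, so \<open>y\<close> would stay within 1 of an unbounded sequence.\<close>
  have "\<bar>\<theta> * real m - y\<bar> < 1" for m
  proof -
    define g where "g = replicate m (Gen_a, True)"
    have "reduced_word g"
      using reduced_append_replicate[of "[]" "(Gen_a, True)" m] by (simp add: g_def)
    from \<epsilon>(2)[OF y[OF this]] have "orbit_close 1 (\<theta> * length g) y"
      unfolding t_def by (simp only: orbit_close_act)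
    then show ?thesis
      by (simp add: orbit_close_iff g_def)
  qed
  moreover obtain m where "real m * \<theta> > y + 1"
    using reals_Archimedean3[of \<theta>] \<eta>(1) unfolding \<theta>_def by (metis half_gt_zero)
  ultimately show False
    by (metis abs_less_iff diff_less_eq add.commute mult.commute not_less_iff_gr_or_eq)
qed


text \<open>If for every \<open>\<epsilon>\<close> some interval had an
  \<open>\<epsilon>\<close>-small orbit, density would spread this over the line and give
  equicontinuity. Hence at some scale no interval has a small orbit. Then exceptional letters of
  overlapping intervals agree, and the same letter serves everywhere.\<close>

lemma dense_orbits_not_shadowing:
  assumes dense: "\<And>x a b. a < b \<Longrightarrow> \<exists>w. \<exists>k::int. a < act w x + 2 * pi * k \<and> act w x + 2 * pi * k < b"
  shows "\<not> line_shadowing"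
proof
  assume shadowing: "line_shadowing"
  have "\<exists>\<epsilon>>0. \<forall>x y. x < y \<longrightarrow> \<not> orbit_close \<epsilon> x y"
  proof (rule ccontr)
    assume no: "\<not> ?thesis"
    have "\<exists>\<delta>>0. \<forall>p q. \<bar>p - q\<bar> < \<delta> \<longrightarrow> orbit_close \<epsilon> p q" if "\<epsilon> > 0" for \<epsilon>
    proof -
      obtain x y where xy: "x < y" "orbit_close \<epsilon> x y"
        using no \<open>\<epsilon> > 0\<close> by blast
      \<comment> \<open>By density the preimages of the interval under all words and translations
        cover the line; a Lebesgue number for one period is the modulus of equicontinuity.\<close>
      define V where "V w k = {r. x < act w r + 2 * pi * of_int k \<and> act w r + 2 * pi * of_int k < y}"
        for w and k :: int
      have V_close: "orbit_close \<epsilon> p q" if "p \<in> V w k" "q \<in> V w k" for p q w k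
      proof -
        let ?f = "\<lambda>r. act w r + 2 * pi * of_int k"
        have "orbit_close \<epsilon> (min (?f p) (?f q)) (max (?f p) (?f q))"
          using that by (intro orbit_close_subinterval[OF xy(2)]) (auto simp: V_def)
        then have "orbit_close \<epsilon> (?f p) (?f q)"
          by (auto simp: min_def max_def orbit_close_def abs_minus_commute split: if_splits)
        then show ?thesis
          by (simp only: orbit_close_translate orbit_close_act)
      qed
      have "open (V w k)" for w k
        unfolding V_def by (intro open_Collect_conj open_Collect_less continuous_intros act_continuous)
      then have opn: "open G" if "G \<in> range (\<lambda>(w, k). V w k)" for G
        using that by auto
      have "p \<in> \<Union> (range (\<lambda>(w, k). V w k))" for p
        using dense[OF xy(1), of p] by (auto simp: V_def)
      then have "{0..2 * pi} \<subseteq> \<Union> (range (\<lambda>(w, k). V w k))"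
        by blast
      from Heine_Borel_lemma[OF compact_Icc this opn]
      obtain e where e: "e > 0" "\<And>p. p \<in> {0..2 * pi} \<Longrightarrow> \<exists>w k. ball p e \<subseteq> V w k"
        by (metis (no_types, lifting) imageE case_prod_beta)
      have "orbit_close \<epsilon> p q" if pq: "\<bar>p - q\<bar> < e" for p q
      proof -
        obtain j :: int where "0 \<le> p + 2 * pi * of_int j" "p + 2 * pi * of_int j < 2 * pi"
          using translate_into_period[of 0 p] by auto
        then obtain w k where "ball (p + 2 * pi * of_int j) e \<subseteq> V w k"
          using e(2) by (meson atLeastAtMost_iff less_imp_le)
        then have "orbit_close \<epsilon> (p + 2 * pi * of_int j) (q + 2 * pi * of_int j)"
          using pq e(1) by (intro V_close[of _ w k]) (auto simp: dist_real_def subset_iff)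
        then show ?thesis
          by (simp only: orbit_close_translate)
      qed
      then show ?thesis using e(1) by blast
    qed
    then show False
      using equicontinuous_not_shadowing shadowing by blast
  qed
  then obtain \<epsilon> where \<epsilon>: "\<epsilon> > 0" and expansive: "\<And>x y. x < y \<Longrightarrow> \<not> orbit_close \<epsilon> x y"
    by blast
  obtain \<delta> where \<delta>: "\<delta> > 0" "\<delta> \<le> \<epsilon>" and split:
    "\<And>p q A. p \<le> q \<Longrightarrow> q < p + \<delta> \<Longrightarrow>
       \<exists>z. p \<le> z \<and> z \<le> q \<and> branch_close \<epsilon> A p z \<and> branch_close \<epsilon> (- A) z q"
    using shadowing_imp_splitting[OF shadowing \<epsilon>] by metis
  have not_UNIV: "\<not> branch_close \<epsilon> UNIV r r'" if "r < r'" "r' < r + \<epsilon>" for r r'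
    using expansive[OF that(1)] that by (simp add: orbit_close_iff)
  have unique: "s = s'"
    if "branch_close \<epsilon> (- {s}) p q" "branch_close \<epsilon> (- {s'}) p' q'"
       "max p p' < min q q'" "q < p + \<epsilon>" for s s' p q p' q'
  proof (rule ccontr)
    assume "s \<noteq> s'"
    then have "- {s} \<union> - {s'} = UNIV" by auto
    moreover have "branch_close \<epsilon> (- {s}) (max p p') (min q q')"
      "branch_close \<epsilon> (- {s'}) (max p p') (min q q')"
      using that by (auto intro: branch_close_subinterval)
    ultimately have "branch_close \<epsilon> UNIV (max p p') (min q q')"
      by (metis branch_close_Un)
    then show False
      using not_UNIV that by fastforce
  qed
  have "\<exists>s. branch_close \<epsilon> (- {s}) p (p + \<delta> / 2)" for p
  proof (rule expanding_branch[of p "p + \<delta> / 2" \<epsilon>])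
    show "\<exists>z. p \<le> z \<and> z \<le> p + \<delta> / 2 \<and> branch_close \<epsilon> A p z \<and> branch_close \<epsilon> (- A) z (p + \<delta> / 2)" for A
      using split[of p "p + \<delta> / 2"] \<delta>(1) by simp
  qed (use \<delta> expansive in auto)
  then obtain \<tau> where \<tau>: "\<And>p. branch_close \<epsilon> (- {\<tau> p}) p (p + \<delta> / 2)"
    by metis
  \<comment> \<open>Intervals at nearby base points overlap, so \<open>\<tau>\<close> is locally
    constant on the connected line.\<close>
  have "\<tau> constant_on UNIV"
  proof (rule locally_constant_imp_constant)
    fix p :: real
    have "\<tau> x = \<tau> p" if "x \<in> ball p (\<delta> / 4)" for x
    proof (rule unique[OF \<tau> \<tau>])
      have "p < x + \<delta> / 2 \<and> x < p + \<delta> / 2 \<and> x < x + \<delta> / 2 \<and> p < p + \<delta> / 2"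
        using that \<delta>(1) unfolding mem_ball dist_real_def by linarith
      then show "max x p < min (x + \<delta> / 2) (p + \<delta> / 2)"
        by simp
    qed (use \<delta> in simp)
    then show "\<exists>T. openin (top_of_set UNIV) T \<and> p \<in> T \<and> (\<forall>x\<in>T. \<tau> x = \<tau> p)"
    proof (intro exI[of _ "ball p (\<delta> / 4)"] conjI ballI)
      show "p \<in> ball p (\<delta> / 4)"
        using \<delta>(1) by simp
    qed simp
  qed simp
  then obtain s where s: "\<And>p. branch_close \<epsilon> (- {s}) p (p + \<delta> / 2)"
    using \<tau> unfolding constant_on_def by (metis UNIV_I)
  obtain u where u: "u \<noteq> s" "u \<noteq> inv_letter s" "s \<noteq> inv_letter u"
    using exists_other_letter by blast
  obtain \<eta> where \<eta>: "\<eta> > 0" "\<And>x y. \<bar>x - y\<bar> < \<eta> \<Longrightarrow> \<bar>F u x - F u y\<bar> < \<delta> / 2"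
    using F_unif_finite[OF half_gt_zero[OF \<delta>(1)]] by blast
  \<comment> \<open>Keeps \<open>[0, q]\<close> inside the interval based at 0 and its image under
    \<open>F u\<close> shorter than \<open>\<delta> / 2\<close>.\<close>
  define q where "q = min (\<delta> / 2) (\<eta> / 2)"
  have q: "0 < q" "q \<le> \<delta> / 2" "q < \<eta>"
    using \<delta>(1) \<eta>(1) by (auto simp: q_def)
  have "branch_close \<epsilon> (- {s}) 0 q"
    using branch_close_subinterval[OF s[of 0], of 0 q] q by simp
  then have "branch_close \<epsilon> {u} 0 q"
    using u by (elim branch_close_mono) auto
  then have F_close: "branch_close \<epsilon> {s} (F u 0) (F u q)"
    using branch_close_act_replicate[of \<epsilon> u 0 q s 1] u by auto
  have "F u 0 \<noteq> F u q"
    using q act_inj[of "[u]"] by (auto simp: inj_def)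
  define r r' where "r = min (F u 0) (F u q)" and "r' = max (F u 0) (F u q)"
  have rr': "r < r'" "r' < r + \<delta> / 2"
    using \<open>F u 0 \<noteq> F u q\<close> \<eta>(2)[of 0 q] q unfolding r_def r'_def
    by (auto simp: min_def max_def abs_if split: if_splits)
  have "branch_close \<epsilon> {s} r r'"
    using F_close branch_close_sym by (auto simp: r_def r'_def min_def max_def)
  moreover have "branch_close \<epsilon> (- {s}) r r'"
    using branch_close_subinterval[OF s[of r], of r r'] rr' by simp
  ultimately have "branch_close \<epsilon> ({s} \<union> - {s}) r r'"
    by (simp only: branch_close_Un)
  then show False
    using not_UNIV[of r r'] rr' \<delta> by simp
qed

section \<open>Finite orbits\<close>

lemma strict_mono_act_diff:
  assumes "strict_mono (act v) \<longleftrightarrow> strict_mono (act w)"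
  shows "strict_mono (act (inv_word v @ w))"
proof (rule ccontr)
  assume "\<not> ?thesis"
  then have *: "act (inv_word v @ w) 1 < act (inv_word v @ w) 0"
    using act_monotone[of "inv_word v @ w"] by simp
  show False
  proof (cases "strict_mono (act v)")
    case True
    then have "act w 1 < act w 0"
      using strict_monoD[OF True *] by (simp add: act_append)
    then show False
      using assms True strict_monoD[of "act w" 0 1] by simp
  next
    case False
    then have "act v (act (inv_word v @ w) 0) < act v (act (inv_word v @ w) 1)"
      using * act_monotone[of v] by blast
    moreover have "act w 1 < act w 0"
      using assms False act_monotone[of w] by simp
    ultimately show False
      by (simp add: act_append)
  qed
qed

text \<open>The words fixing the finite set pointwise and preserving orientation form a subgroup of
  finite index, given here as a fibre of a map with finite range. Its fixed points are the whole
  line, since at the left end of a gap the maximal interval with small orbit is again fixed.\<close>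

lemma finite_orbit_not_shadowing:
  assumes X: "finite X" "X \<noteq> {}" "\<And>w x. x \<in> X \<Longrightarrow> cis (act w x) \<in> cis ` X"
  shows "\<not> line_shadowing"
proof
  assume shadowing: "line_shadowing"
  \<comment> \<open>The fibre of \<open>D []\<close> is the finite-index subgroup, and the other
    fibres are its left cosets. \<open>restrict\<close> keeps the function space finite.\<close>
  define D where "D w = (restrict (\<lambda>x. cis (act w x)) X, strict_mono (act w))" for w
  have "range D \<subseteq> (X \<rightarrow>\<^sub>E cis ` X) \<times> UNIV"
    using X(3) by (auto simp: D_def)
  then have finite_D: "finite (range D)"
    using X(1) by (elim finite_subset) (auto intro!: finite_cartesian_product finite_PiE)
  have D_Nil: "D w = D [] \<longleftrightarrow> strict_mono (act w) \<and> (\<forall>x\<in>X. cis (act w x) = cis x)" for w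
    by (auto simp: D_def restrict_def fun_eq_iff strict_mono_def split: if_splits)
  have D_diff: "D (inv_word v @ w) = D []" if "D v = D w" for v w
  proof -
    have "strict_mono (act (inv_word v @ w))"
      using that by (intro strict_mono_act_diff) (simp add: D_def)
    moreover have "cis (act (inv_word v @ w) x) = cis x" if "x \<in> X" for x
    proof -
      have "cis (act w x) = cis (act v x)"
        using \<open>D v = D w\<close> \<open>x \<in> X\<close> by (auto simp: D_def restrict_def fun_eq_iff split: if_splits)
      from cis_act_cong[OF this, of "inv_word v"] show ?thesis
        by (simp add: act_append)
    qed
    ultimately show ?thesis by (simp add: D_Nil)
  qed
  define Fx where "Fx = {x. \<forall>w. D w = D [] \<longrightarrow> cis (act w x) = cis x}"
  \<comment> \<open>Otherwise some branch \<open>s\<close> expands at \<open>c\<close>. By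
    pigeonhole a power of \<open>u\<close> lies in the subgroup, so up to translation it fixes
    \<open>c\<close> and keeps the right side on the right. The image interval is close on branch
    \<open>s\<close>, a contradiction.\<close>
  have germ: "\<exists>z>c. orbit_close \<epsilon> c z" if c: "c \<in> Fx" and \<epsilon>: "\<epsilon> > 0" for c \<epsilon>
  proof (rule ccontr)
    assume exp: "\<not> ?thesis"
    obtain \<delta> where \<delta>: "\<delta> > 0" "\<delta> \<le> \<epsilon>" and split:
      "\<And>p q A. p \<le> q \<Longrightarrow> q < p + \<delta> \<Longrightarrow>
         \<exists>z. p \<le> z \<and> z \<le> q \<and> branch_close \<epsilon> A p z \<and> branch_close \<epsilon> (- A) z q"
      using shadowing_imp_splitting[OF shadowing \<epsilon>] by metis
    define q where "q = c + \<delta> / 2"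
    obtain s where s: "branch_close \<epsilon> (- {s}) c q" "\<And>z. c < z \<Longrightarrow> \<not> branch_close \<epsilon> {s} c z"
      using expanding_branch[of c q \<epsilon>] split[of c q] exp \<delta> by (auto simp: q_def)
    obtain u where u: "u \<noteq> s" "u \<noteq> inv_letter s" "s \<noteq> inv_letter u"
      using exists_other_letter by blast
    have "\<not> inj (\<lambda>n. D (replicate n u))"
      using finite_D finite_subset[of "range (\<lambda>n. D (replicate n u))" "range D"]
      by (auto simp: finite_image_iff dest: finite_imageD)
    then obtain i j where ij: "i < j" "D (replicate i u) = D (replicate j u)"
      unfolding inj_def by (metis linorder_neqE_nat)
    define w where "w = replicate (j - i) u"
    have "act (inv_word (replicate i u) @ replicate j u) = act w"
    proof
      fix x
      have "replicate j u = replicate i u @ w"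
        using ij(1) by (simp add: w_def replicate_add[symmetric])
      then show "act (inv_word (replicate i u) @ replicate j u) x = act w x"
        by (simp add: act_append)
    qed
    then have "D w = D []"
      using D_diff[OF ij(2)] by (simp add: D_def)
    then have "strict_mono (act w)" "cis (act w c) = cis c"
      using c by (auto simp: D_Nil Fx_def)
    then obtain k :: int where k: "act w c = c + 2 * pi * k"
      by (auto simp: cis_eq_cis_iff)
    have "act w c < act w q"
      using \<delta>(1) \<open>strict_mono (act w)\<close> by (simp add: q_def strict_monoD)
    have "branch_close \<epsilon> {u} c q"
      using s(1) u by (elim branch_close_mono) auto
    then have "branch_close \<epsilon> {s} (act w c) (act w q)"
      unfolding w_def using u ij(1) by (intro branch_close_act_replicate) auto
    then have "branch_close \<epsilon> {s} c (act w q - 2 * pi * k)"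
      using branch_close_translate[of \<epsilon> "{s}" c k "act w q - 2 * pi * k"] k by simp
    then show False
      using s(2)[of "act w q - 2 * pi * k"] k \<open>act w c < act w q\<close> by simp
  qed
  have "closed Fx"
    unfolding Fx_def cis_conv_exp
    by (intro closed_Collect_all closed_Collect_imp open_Collect_const closed_Collect_eq
        continuous_intros act_continuous)
  have translate: "x + 2 * pi * of_int k \<in> Fx" if "x \<in> Fx" for x k
  proof -
    have cis_x: "cis (x + 2 * pi * of_int k) = cis x"
      by (auto simp: cis_eq_cis_iff)
    show ?thesis
      using that cis_act_cong[OF cis_x] cis_x by (simp add: Fx_def)
  qed
  have "X \<subseteq> Fx"
    by (auto simp: Fx_def D_Nil)
  have "x \<in> Fx" for x
  proof (rule ccontr)
    assume x: "x \<notin> Fx"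
    obtain x0 where x0: "x0 \<in> X"
      using X(2) by blast
    obtain j :: int where "x - 2 * pi \<le> x0 + 2 * pi * of_int j" "x0 + 2 * pi * of_int j < x"
      using translate_into_period[of "x - 2 * pi" x0] by auto
    then have ne: "x0 + 2 * pi * of_int j \<in> Fx \<inter> {..x}"
      using translate x0 \<open>X \<subseteq> Fx\<close> by auto
    define c where "c = Sup (Fx \<inter> {..x})"
    have bdd: "bdd_above (Fx \<inter> {..x})"
      by (meson Int_lower2 bdd_above_Iic bdd_above_mono)
    then have "c \<in> Fx \<inter> {..x}"
      unfolding c_def using ne \<open>closed Fx\<close> by (intro closed_contains_Sup closed_Int) auto
    then have c: "c \<in> Fx" "c < x"
      using x by (auto simp: order.strict_iff_order)
    have gap: "y \<le> c" if "y \<in> Fx" "y \<le> x" for y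
      unfolding c_def using that bdd by (intro cSup_upper) auto
    \<comment> \<open>Half the distance to \<open>x\<close>: taking the empty word for
      \<open>w\<close> shows that no point of \<open>Z\<close> reaches \<open>x\<close>.\<close>
    define \<epsilon> where "\<epsilon> = (x - c) / 2"
    \<comment> \<open>The non-strict inequality, unlike that of \<open>orbit_close\<close>, makes
      \<open>Z\<close> closed, so its supremum belongs to it.\<close>
    define Z where "Z = {z. c \<le> z \<and> (\<forall>w. \<bar>act w c - act w z\<bar> \<le> \<epsilon>)}"
    have Z_less: "z < x" if "z \<in> Z" for z
    proof -
      have "\<bar>act [] c - act [] z\<bar> \<le> \<epsilon>"
        using that unfolding Z_def by blast
      then have "z - c \<le> \<epsilon>"
        by (simp add: abs_le_iff)
      then show ?thesis
        using c(2) by (simp add: \<epsilon>_def field_simps)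
    qed
    have "closed Z"
      unfolding Z_def
      by (intro closed_Collect_conj closed_Collect_all closed_Collect_le continuous_intros act_continuous)
    obtain z0 where z0: "z0 > c" "orbit_close \<epsilon> c z0"
      using germ[OF c(1), of \<epsilon>] c(2) by (auto simp: \<epsilon>_def)
    then have "z0 \<in> Z"
      by (auto simp: Z_def orbit_close_def intro: less_imp_le)
    have bddZ: "bdd_above Z"
      using Z_less by (meson bdd_above.I less_imp_le)
    define m where "m = Sup Z"
    have m: "m \<in> Z"
      unfolding m_def using \<open>z0 \<in> Z\<close> bddZ \<open>closed Z\<close> by (intro closed_contains_Sup) auto
    have m_max: "z \<le> m" if "z \<in> Z" for z
      unfolding m_def using that bddZ by (rule cSup_upper)
    \<comment> \<open>Up to translation, a subgroup element keeps \<open>m\<close> in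
      \<open>Z\<close>, since it only replaces the tested word \<open>v\<close> by
      \<open>v @ w\<close>. Applied to the inverse word as well, this makes \<open>m\<close> a fixed
      point inside the gap.\<close>
    have act_m: "act w m - 2 * pi * k \<le> m"
      if "D w = D []" "act w c = c + 2 * pi * of_int k" for w k
    proof (rule m_max)
      have "c \<le> act w m - 2 * pi * k"
        using that(1,2) m strict_mono_less_eq[of "act w" c m] by (simp add: D_Nil Z_def)
      moreover have "\<bar>act v c - act v (act w m - 2 * pi * k)\<bar> \<le> \<epsilon>" for v
      proof -
        have "act v c - act v (act w m - 2 * pi * k) = act (v @ w) c - act (v @ w) m"
          using act_translate_diff[of v c k "act w m - 2 * pi * k"] that(2) by (simp add: act_append)
        then show ?thesis
          using m by (simp add: Z_def)
      qed
      ultimately show "act w m - 2 * pi * k \<in> Z"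
        by (simp add: Z_def)
    qed
    have "cis (act w m) = cis m" if w: "D w = D []" for w
    proof -
      have w': "D (inv_word w) = D []"
        using D_diff[of w "[]"] w by simp
      obtain k :: int where k: "act w c = c + 2 * pi * k"
        using c(1) w by (auto simp: Fx_def cis_eq_cis_iff)
      obtain k' :: int where k': "act (inv_word w) c = c + 2 * pi * k'"
        using c(1) w' by (auto simp: Fx_def cis_eq_cis_iff)
      have "m = act w (act (inv_word w) m)"
        by simp
      also have "\<dots> \<le> act w (m + 2 * pi * k')"
        using act_m[OF w' k'] w by (subst strict_mono_less_eq) (auto simp: D_Nil)
      also have "\<dots> = act w m + (act w (act (inv_word w) c) - act w c)"
        using act_translate_diff[of w m k' c] k' by simp
      also have "\<dots> = act w m - 2 * pi * k"
        using k by simp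
      finally have "act w m = m + 2 * pi * k"
        using act_m[OF w k] by simp
      then show ?thesis
        by (auto simp: cis_eq_cis_iff)
    qed
    then have "m \<in> Fx"
      by (simp add: Fx_def)
    then show False
      using gap[of m] Z_less[OF m] m_max[OF \<open>z0 \<in> Z\<close>] z0(1) by linarith
  qed
  \<comment> \<open>The subgroup now fixes the whole circle, so up to translation
    \<open>act w\<close> depends only on \<open>D w\<close>, and finitely many moduli of continuity
    suffice.\<close>
  have D_act: "act v p - act v q = act w p - act w q" if "D v = D w" for v w p q
  proof -
    have "cis (act w x) = cis (act v x)" for x
    proof -
      have "cis (act (inv_word v @ w) x) = cis x"
        using \<open>x \<in> Fx\<close> D_diff[OF that] by (simp add: Fx_def)
      from cis_act_cong[OF this, of v] show ?thesis
        by (simp add: act_append)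
    qed
    then obtain k :: int where "\<And>x. act w x = act v x + 2 * pi * k"
      using cis_eq_imp_constant_difference[OF act_continuous act_continuous] by metis
    then show ?thesis by simp
  qed
  have "\<exists>\<delta>>0. \<forall>p q. \<bar>p - q\<bar> < \<delta> \<longrightarrow> orbit_close \<epsilon> p q" if "\<epsilon> > 0" for \<epsilon>
  proof -
    obtain R where R: "finite R" "range D = D ` R"
      using finite_subset_image[OF finite_D subset_refl] by blast
    have "\<forall>w. \<exists>d>0. \<forall>p q. \<bar>p - q\<bar> < d \<longrightarrow> \<bar>act w p - act w q\<bar> < \<epsilon>"
      using act_uniformly_continuous that by blast
    then obtain d where d: "\<And>w. d w > 0" "\<And>w p q. \<bar>p - q\<bar> < d w \<Longrightarrow> \<bar>act w p - act w q\<bar> < \<epsilon>"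
      by metis
    have "orbit_close \<epsilon> p q" if "\<bar>p - q\<bar> < Min (insert 1 (d ` R))" for p q
      unfolding orbit_close_def
    proof
      fix w
      obtain v where "v \<in> R" "D w = D v"
        using R(2) by (metis imageE rangeI)
      then show "\<bar>act w p - act w q\<bar> < \<epsilon>"
        using that R(1) d(2)[of p q v] D_act[of w v p q] by simp
    qed
    then show ?thesis
      using R(1) d(1) by (intro exI[of _ "Min (insert 1 (d ` R))"]) auto
  qed
  then show False
    using equicontinuous_not_shadowing shadowing by blast
qed

end

section \<open>Minimal sets on the circle\<close>

lemma dynamical_system_facts:
  assumes "dynamical_system G X \<Phi>" "g \<in> carrier G"
  shows action_continuous: "continuous_on X (\<Phi> g)"
    and action_image: "\<Phi> g ` X = X"
    and action_mult: "\<And>h x. h \<in> carrier G \<Longrightarrow> x \<in> X \<Longrightarrow> \<Phi> g (\<Phi> h x) = \<Phi> (g \<otimes>\<^bsub>G\<^esub> h) x"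
    and action_inv: "\<And>x. x \<in> X \<Longrightarrow> \<Phi> (inv\<^bsub>G\<^esub> g) (\<Phi> g x) = x"
proof -
  interpret group G
    using assms(1) by (simp add: dynamical_system_def)
  have hom: "homeomorphic_map (top_of_set X) (top_of_set X) (\<Phi> h)" if "h \<in> carrier G" for h
    using assms(1) that by (simp add: dynamical_system_def)
  show "continuous_on X (\<Phi> g)"
    using homeomorphic_imp_continuous_map[OF hom[OF assms(2)]] by simp
  have image: "\<Phi> h ` X = X" if "h \<in> carrier G" for h
    using homeomorphic_imp_surjective_map[OF hom[OF that]] by simp
  then show "\<Phi> g ` X = X"
    using assms(2) .
  have mult: "\<Phi> g (\<Phi> h x) = \<Phi> (g \<otimes>\<^bsub>G\<^esub> h) x" if "g \<in> carrier G" "h \<in> carrier G" "x \<in> X" for g h x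
    using assms(1) that by (simp add: dynamical_system_def)
  then show "\<Phi> g (\<Phi> h x) = \<Phi> (g \<otimes>\<^bsub>G\<^esub> h) x" if "h \<in> carrier G" "x \<in> X" for h x
    using assms(2) that by blast
  \<comment> \<open>The identity is not assumed to act trivially; it does because its map is
    idempotent and surjective.\<close>
  have "\<Phi> \<one>\<^bsub>G\<^esub> x = x" if x: "x \<in> X" for x
  proof -
    obtain y where "y \<in> X" "x = \<Phi> \<one>\<^bsub>G\<^esub> y"
      using image[OF one_closed] x by blast
    then show ?thesis
      using mult[of "\<one>\<^bsub>G\<^esub>" "\<one>\<^bsub>G\<^esub>" y] by simp
  qed
  then show "\<Phi> (inv\<^bsub>G\<^esub> g) (\<Phi> g x) = x" if "x \<in> X" for x
    using mult[of "inv\<^bsub>G\<^esub> g" g x] that assms(2) by simp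
qed

lemma minimal_set_facts:
  assumes "dynamical_system G X \<Phi>" "minimal_set G X \<Phi> M"
  shows minimal_set_closedin: "closedin (top_of_set X) M"
    and minimal_set_invariant: "\<And>g x. g \<in> carrier G \<Longrightarrow> x \<in> M \<Longrightarrow> \<Phi> g x \<in> M"
    and minimal_set_dense: "\<And>x V. x \<in> M \<Longrightarrow> open V \<Longrightarrow> V \<inter> M \<noteq> {} \<Longrightarrow> \<exists>g\<in>carrier G. \<Phi> g x \<in> V"
proof -
  have M: "M \<noteq> {}" "M \<subseteq> X" "\<And>x. x \<in> M \<Longrightarrow> top_of_set X closure_of orbit G \<Phi> x = M"
    using assms(2) by (auto simp: minimal_set_def)
  show "closedin (top_of_set X) M"
    using M by (metis closedin_closure_of ex_in_conv)
  show "\<Phi> g x \<in> M" if "g \<in> carrier G" "x \<in> M" for g x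
  proof -
    have "orbit G \<Phi> x \<subseteq> topspace (top_of_set X)"
      using action_image[OF assms(1)] that(2) M(2) by (auto simp: orbit_def)
    then have "orbit G \<Phi> x \<subseteq> M"
      using closure_of_subset M(3)[OF that(2)] by blast
    then show ?thesis
      using that(1) by (auto simp: orbit_def)
  qed
  show "\<exists>g\<in>carrier G. \<Phi> g x \<in> V" if xV: "x \<in> M" "open V" "V \<inter> M \<noteq> {}" for x V
  proof -
    have "V \<inter> top_of_set X closure_of orbit G \<Phi> x \<noteq> {}"
      using xV M(3) by simp
    then obtain y where y: "y \<in> V" "y \<in> top_of_set X closure_of orbit G \<Phi> x"
      by blast
    have "openin (top_of_set X) (X \<inter> V)" "y \<in> X"
      using xV(2) y(2) by (auto simp: openin_open_Int in_closure_of)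
    then obtain z where "z \<in> orbit G \<Phi> x" "z \<in> X \<inter> V"
      using y unfolding in_closure_of by blast
    then show ?thesis
      by (auto simp: orbit_def)
  qed
qed

text \<open>By compactness \<open>M\<close> has some limit point \<open>x\<close>. Its orbit enters
  a neighbourhood isolating \<open>y\<close>, and the preimage of that neighbourhood would isolate
  \<open>x\<close>.\<close>

lemma infinite_minimal_set_perfect:
  assumes "dynamical_system G X \<Phi>" "minimal_set G X \<Phi> M" "compact X" "infinite M" "y \<in> M"
  shows "y islimpt M"
proof (rule ccontr)
  assume "\<not> y islimpt M"
  then obtain V where V: "open V" "y \<in> V" "V \<inter> M \<subseteq> {y}"
    unfolding islimpt_def by blast
  have "M \<subseteq> X"
    using assms(2) by (simp add: minimal_set_def)
  have "compact M"
    using closedin_compact[OF assms(3) minimal_set_closedin[OF assms(1,2)]] .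
  then obtain x where x: "x \<in> M" "x islimpt M"
    using assms(4) by (metis compact_eq_Bolzano_Weierstrass subset_refl)
  obtain g where g: "g \<in> carrier G" "\<Phi> g x \<in> V"
    using minimal_set_dense[OF assms(1,2) x(1) V(1)] V(2) assms(5) by blast
  have eq: "z = x" if "z \<in> M" "\<Phi> g z \<in> V" for z
  proof -
    have "\<Phi> g z = \<Phi> g x"
      using minimal_set_invariant[OF assms(1,2) g(1)] V(3) g(2) that x(1) by blast
    then show ?thesis
      using action_inv[OF assms(1) g(1)] that(1) x(1) \<open>M \<subseteq> X\<close> by (metis subsetD)
  qed
  have "openin (top_of_set X) (X \<inter> \<Phi> g -` V)"
    using action_continuous[OF assms(1) g(1)] V(1) by (rule continuous_openin_preimage_gen)
  then obtain W where W: "open W" "X \<inter> \<Phi> g -` V = X \<inter> W"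
    unfolding openin_open by blast
  have "x \<in> W"
    using W(2) g(2) x(1) \<open>M \<subseteq> X\<close> by blast
  then obtain z where "z \<in> M" "z \<in> W" "z \<noteq> x"
    using x(2) W(1) unfolding islimpt_def by blast
  then show False
    using eq W(2) \<open>M \<subseteq> X\<close> by blast
qed

text \<open>Every orbit in \<open>M\<close> enters \<open>V\<close>; pulling \<open>V\<close> back
  gives a neighbourhood inside \<open>M\<close>, by invariance. So \<open>M\<close> is
  clopen.\<close>

lemma minimal_set_with_interior:
  assumes "dynamical_system G X \<Phi>" "minimal_set G X \<Phi> M" "connected X"
    and V: "open V" "V \<inter> X \<noteq> {}" "V \<inter> X \<subseteq> M"
  shows "M = X"
proof -
  have M: "M \<noteq> {}" "M \<subseteq> X"
    using assms(2) by (auto simp: minimal_set_def)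
  interpret group G
    using assms(1) by (simp add: dynamical_system_def)
  have "openin (top_of_set X) M"
  proof (subst openin_subopen, intro ballI)
    fix x assume x: "x \<in> M"
    obtain g where g: "g \<in> carrier G" "\<Phi> g x \<in> V"
      using minimal_set_dense[OF assms(1,2) x V(1)] V(2,3) by blast
    show "\<exists>T. openin (top_of_set X) T \<and> x \<in> T \<and> T \<subseteq> M"
    proof (intro exI conjI)
      show "openin (top_of_set X) (X \<inter> \<Phi> g -` V)"
        using action_continuous[OF assms(1) g(1)] V(1) by (rule continuous_openin_preimage_gen)
      show "x \<in> X \<inter> \<Phi> g -` V"
        using g(2) x M(2) by blast
      show "X \<inter> \<Phi> g -` V \<subseteq> M"
      proof
        fix z assume z: "z \<in> X \<inter> \<Phi> g -` V"
        then have "\<Phi> g z \<in> M"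
          using action_image[OF assms(1) g(1)] V(3) by blast
        then have "\<Phi> (inv\<^bsub>G\<^esub> g) (\<Phi> g z) \<in> M"
          using minimal_set_invariant[OF assms(1,2)] g(1) by simp
        then show "z \<in> M"
          using action_inv[OF assms(1) g(1)] z by simp
      qed
    qed
  qed
  then show ?thesis
    using assms(3) minimal_set_closedin[OF assms(1,2)] M(1) unfolding connected_clopen by blast
qed

text \<open>The complementary arc is compact, which yields openness of the arc in the
  circle.\<close>

lemma cis_image_arc:
  assumes "a < b" "b < a + 2 * pi"
  shows "cis ` {a<..<b} = circle - cis ` {b..a + 2 * pi}"
proof (intro equalityI subsetI)
  fix z assume "z \<in> cis ` {a<..<b}"
  then obtain r where r: "z = cis r" "a < r" "r < b"
    by auto
  have ne: "cis r \<noteq> cis r'" if r': "r' \<in> {b..a + 2 * pi}" for r'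
  proof
    assume "cis r = cis r'"
    then obtain k :: int where k: "r' = r + 2 * pi * k"
      by (metis cis_eq_cis_iff)
    then have "2 * pi * 0 < 2 * pi * k" "2 * pi * k < 2 * pi * 1"
      using r r' unfolding atLeastAtMost_iff by linarith+
    then have "0 < real_of_int k" "real_of_int k < 1"
      by (simp_all only: mult_less_cancel_left_pos zero_less_mult_iff pi_gt_zero zero_less_numeral simp_thms)
    then have "0 < k" "k < 1"
      by simp_all
    then show False by simp
  qed
  then show "z \<in> circle - cis ` {b..a + 2 * pi}"
    using ne unfolding r(1) by (auto simp: image_iff)
next
  fix z assume z: "z \<in> circle - cis ` {b..a + 2 * pi}"
  obtain k :: int where k: "a \<le> Arg z + 2 * pi * k" "Arg z + 2 * pi * k < a + 2 * pi"
    using translate_into_period[of a "Arg z"] by blast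
  define r where "r = Arg z + 2 * pi * k"
  have "cis r = z"
    using z cis_Arg_circle by (simp add: r_def)
  then have "cis (r + 2 * pi) = z"
    by (simp add: complex_eq_iff)
  have notin: "r' \<notin> {b..a + 2 * pi}" if "cis r' = z" for r'
    using z that by blast
  have "r \<notin> {b..a + 2 * pi}" "r \<noteq> a"
    using notin[OF \<open>cis r = z\<close>] notin[OF \<open>cis (r + 2 * pi) = z\<close>] assms by auto
  then have "a < r" "r < b"
    using k by (auto simp: r_def)
  then show "z \<in> cis ` {a<..<b}"
    using \<open>cis r = z\<close> by auto
qed

lemma compact_cis_image: "compact (cis ` {a..b})"
  by (intro compact_continuous_image continuous_intros) simp

text \<open>An arc with endpoints off \<open>C\<close> meets \<open>C\<close> in a clopen set.
  Without interior such endpoints are dense, and rational ones give a countable separating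
  family.\<close>

lemma cantor_set_in_circle:
  assumes "closed C" "C \<subseteq> circle" "C \<noteq> {}"
    and perfect: "\<And>x. x \<in> C \<Longrightarrow> x islimpt C"
    and no_interior: "\<And>V. open V \<Longrightarrow> V \<inter> circle \<noteq> {} \<Longrightarrow> \<not> V \<inter> circle \<subseteq> C"
  shows "cantor_set C"
proof -
  have gap: "\<exists>r::rat. a < of_rat r \<and> of_rat r < b \<and> cis (of_rat r) \<notin> C"
    if ab: "a < b" "b < a + 2 * pi" for a b :: real
  proof -
    let ?V = "- cis ` {b..a + 2 * pi}"
    have arc: "?V \<inter> circle = cis ` {a<..<b}"
      using cis_image_arc[OF ab] by blast
    have "open ?V"
      using compact_cis_image compact_imp_closed by blast
    moreover have "?V \<inter> circle \<noteq> {}"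
      using ab(1) unfolding arc by simp
    ultimately have "\<not> cis ` {a<..<b} \<subseteq> C"
      using no_interior[of ?V] unfolding arc by blast
    then obtain r0 where r0: "a < r0" "r0 < b" "cis r0 \<notin> C"
      by (metis greaterThanLessThan_iff image_subsetI)
    have "open (cis -` (- C))"
      using assms(1) by (intro open_vimage continuous_intros) auto
    then have "open (cis -` (- C) \<inter> {a<..<b})"
      by (intro open_Int) auto
    moreover have "r0 \<in> cis -` (- C) \<inter> {a<..<b}"
      using r0 by simp
    ultimately obtain e where e: "e > 0" "ball r0 e \<subseteq> cis -` (- C) \<inter> {a<..<b}"
      unfolding open_contains_ball by blast
    obtain r :: rat where "r0 < of_rat r" "of_rat r < r0 + e"
      using of_rat_dense[of r0 "r0 + e"] e(1) by auto
    then have "of_rat r \<in> cis -` (- C) \<inter> {a<..<b}"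
      using e(2) by (intro subsetD[OF e(2)]) (simp add: dist_real_def)
    then show ?thesis by auto
  qed
  define good where "good s t \<longleftrightarrow> s < t \<and> t < s + 2 * pi \<and> cis s \<notin> C \<and> cis t \<notin> C" for s t
  define U where "U n = (case from_nat n of (s, t) \<Rightarrow>
      if good (real_of_rat s) (real_of_rat t) then cis ` {real_of_rat s<..<real_of_rat t} else {})" for n
  have clopen_arc: "openin (top_of_set C) (C \<inter> cis ` {s<..<t})"
      "closedin (top_of_set C) (C \<inter> cis ` {s<..<t})" if "good s t" for s t
  proof -
    have st: "s < t" "t < s + 2 * pi" "cis s \<notin> C" "cis t \<notin> C"
      using that by (auto simp: good_def)
    have "C \<inter> cis ` {s<..<t} = C \<inter> - cis ` {t..s + 2 * pi}"
      using cis_image_arc[OF st(1,2)] assms(2) by blast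
    then show "openin (top_of_set C) (C \<inter> cis ` {s<..<t})"
      using compact_imp_closed[OF compact_cis_image] by (simp add: openin_open_Int open_Compl)
    have "{s..t} = insert s (insert t {s<..<t})"
      using st(1) by auto
    then have "C \<inter> cis ` {s<..<t} = C \<inter> cis ` {s..t}"
      using st by auto
    then show "closedin (top_of_set C) (C \<inter> cis ` {s<..<t})"
      using compact_imp_closed[OF compact_cis_image] by (simp add: closedin_closed_Int)
  qed
  show ?thesis
  proof (rule cantor_set_if_clopen_separating_sequence[where U = U])
    show "compact C"
      using assms(1,2) by (meson bounded_sphere bounded_subset compact_eq_bounded_closed)
    show "openin (top_of_set C) (C \<inter> U n)" "closedin (top_of_set C) (C \<inter> U n)" for n
      using clopen_arc by (auto simp: U_def split: prod.splits)
    show "\<exists>n. x \<in> U n \<and> y \<notin> U n" if xy: "x \<in> C" "y \<in> C" "x \<noteq> y" for x y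
    proof -
      define \<theta> where "\<theta> = Arg x"
      have x: "cis \<theta> = x"
        unfolding \<theta>_def using xy(1) assms(2) cis_Arg_circle by blast
      obtain k :: int where k: "\<theta> \<le> Arg y + 2 * pi * k" "Arg y + 2 * pi * k < \<theta> + 2 * pi"
        using translate_into_period by blast
      define \<psi> where "\<psi> = Arg y + 2 * pi * k"
      have "cis \<psi> = y"
        using xy(2) assms(2) cis_Arg_circle[of y] by (auto simp: \<psi>_def)
      then have \<psi>: "\<theta> < \<psi>" "\<psi> < \<theta> + 2 * pi"
        using k x xy(3) by (auto simp: \<psi>_def[symmetric] order.strict_iff_order)
      \<comment> \<open>\<open>s\<close> above \<open>\<psi> - 2 * pi\<close> puts
        \<open>\<psi>\<close> into the complementary arc from \<open>t\<close> to
        \<open>s + 2 * pi\<close>.\<close>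
      obtain s :: rat where s: "\<psi> - 2 * pi < of_rat s" "of_rat s < \<theta>" "cis (of_rat s) \<notin> C"
        using gap[of "\<psi> - 2 * pi" \<theta>] \<psi> by auto
      obtain t :: rat where t: "\<theta> < of_rat t" "of_rat t < \<psi>" "cis (of_rat t) \<notin> C"
        using gap[of \<theta> \<psi>] \<psi> by auto
      have "good (of_rat s) (of_rat t)"
        using s t by (auto simp: good_def)
      then have U: "U (to_nat (s, t)) = cis ` {real_of_rat s<..<real_of_rat t}"
        by (simp add: U_def)
      have "\<psi> \<in> {of_rat t..of_rat s + 2 * pi}"
        using s t by simp
      then have "y \<notin> cis ` {real_of_rat s<..<real_of_rat t}"
        using cis_image_arc[of "of_rat s" "of_rat t"] s t \<open>cis \<psi> = y\<close> by auto
      moreover have "x \<in> cis ` {real_of_rat s<..<real_of_rat t}"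
        using s t x by auto
      ultimately show ?thesis
        using U by blast
    qed
  qed (use assms in auto)
qed

lemma minimal_set_circle_cases:
  assumes "dynamical_system G circle \<Phi>" "minimal_set G circle \<Phi> M"
  obtains "finite M" | "M = circle" | "cantor_set M"
proof -
  have M: "M \<noteq> {}" "M \<subseteq> circle"
    using assms(2) by (auto simp: minimal_set_def)
  have "cantor_set M" if "infinite M" "M \<noteq> circle"
  proof (rule cantor_set_in_circle)
    show "closed M"
      using minimal_set_closedin[OF assms] closedin_closed_trans by (metis closed_sphere)
    show "x islimpt M" if "x \<in> M" for x
      using infinite_minimal_set_perfect[OF assms _ \<open>infinite M\<close> that] by simp
    show "\<not> V \<inter> circle \<subseteq> M" if "open V" "V \<inter> circle \<noteq> {}" for V
    proof
      assume "V \<inter> circle \<subseteq> M"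
      moreover have "connected circle"
        by (intro connected_sphere) simp
      ultimately show False
        using minimal_set_with_interior[OF assms] that \<open>M \<noteq> circle\<close> by blast
    qed
  qed (use M in auto)
  then show thesis
    using that by blast
qed

section \<open>Lifting to the line\<close>

text \<open>\<open>f (cis x)\<close> never vanishes, so it has a continuous logarithm on the
  contractible line; modulus one makes the imaginary part a lift.\<close>

lemma circle_map_lift:
  assumes "continuous_on circle f" "f \<in> circle \<rightarrow> circle"
  obtains F :: "real \<Rightarrow> real" where "continuous_on UNIV F" "\<And>x. cis (F x) = f (cis x)"
proof -
  have "continuous_on UNIV (\<lambda>x. f (cis x))"
    by (intro continuous_on_compose2[OF assms(1)] continuous_intros) auto
  moreover have norm_1: "norm (f (cis x)) = 1" for x
    using funcset_mem[OF assms(2), of "cis x"] by simp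
  then have "f (cis x) \<noteq> 0" for x
    by (metis norm_zero zero_neq_one)
  moreover have "contractible (UNIV :: real set)"
    by (simp add: convex_imp_contractible)
  ultimately obtain h where h: "continuous_on UNIV h" "\<And>x::real. f (cis x) = exp (h x)"
    using continuous_logarithm_on_contractible[of UNIV "\<lambda>x. f (cis x)"] by auto
  show thesis
  proof
    show "continuous_on UNIV (\<lambda>x. Im (h x))"
      using h(1) by (intro continuous_intros)
    fix x
    have "Re (h x) = 0"
      using norm_1[of x] unfolding h(2) by simp
    then show "cis (Im (h x)) = f (cis x)"
      unfolding h(2) by (simp add: exp_eq_polar)
  qed
qed

lemma circle_homeomorphism_lift:
  assumes "continuous_on circle f" "f \<in> circle \<rightarrow> circle"
    and "continuous_on circle g" "g \<in> circle \<rightarrow> circle"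
    and inv: "\<And>z. z \<in> circle \<Longrightarrow> f (g z) = z" "\<And>z. z \<in> circle \<Longrightarrow> g (f z) = z"
  obtains F G :: "real \<Rightarrow> real" where
    "continuous_on UNIV F" "\<And>x. cis (F x) = f (cis x)"
    "continuous_on UNIV G" "\<And>x. cis (G x) = g (cis x)"
    "\<And>x. F (G x) = x" "\<And>x. G (F x) = x"
proof -
  obtain F where F: "continuous_on UNIV F" "\<And>x. cis (F x) = f (cis x)"
    using circle_map_lift[OF assms(1,2)] by blast
  obtain G where G: "continuous_on UNIV G" "\<And>x. cis (G x) = g (cis x)"
    using circle_map_lift[OF assms(3,4)] by blast
  have "continuous_on UNIV (\<lambda>x. F (G x))" "continuous_on UNIV (\<lambda>x. G (F x))"
    using F(1) G(1) by (auto intro: continuous_on_compose2)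
  moreover have "cis (F (G x)) = cis x" "cis (G (F x)) = cis x" for x
    using F(2) G(2) inv by simp_all
  ultimately obtain j k :: int where jk: "\<And>x. F (G x) = x + 2 * pi * k" "\<And>x. G (F x) = x + 2 * pi * j"
    using cis_eq_imp_constant_difference[of "\<lambda>x. F (G x)" "\<lambda>x. x"]
      cis_eq_imp_constant_difference[of "\<lambda>x. G (F x)" "\<lambda>x. x"] by (metis continuous_on_id)
  \<comment> \<open>Lifts of inverse maps are inverse only up to deck translations; shifting the
    argument of \<open>G\<close> removes the one in \<open>F (G x)\<close>.\<close>
  define G' where "G' x = G (x - 2 * pi * k)" for x
  have FG': "F (G' x) = x" for x
    by (simp add: G'_def jk)
  show thesis
  proof (rule that[OF F _ _ FG'])
    show "continuous_on UNIV G'"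
      unfolding G'_def by (intro continuous_on_compose2[OF G(1)] continuous_intros) auto
    have "cis (x - 2 * pi * k) = cis x" for x
      by (auto simp: cis_eq_cis_iff intro: exI[of _ "- k"])
    then show "cis (G' x) = g (cis x)" for x
      by (simp add: G'_def G(2))
    show "G' (F x) = x" for x
    proof -
      have "G (F (G' (F x))) = G (F x)"
        by (simp add: FG')
      then show ?thesis
        by (simp only: jk add_right_cancel)
    qed
  qed
qed

section \<open>Chords and arcs\<close>

lemma dist_cis_squared: "(dist (cis a) (cis b))\<^sup>2 = 2 - 2 * cos (a - b)"
proof -
  have "(dist (cis a) (cis b))\<^sup>2 = (cos a - cos b)\<^sup>2 + (sin a - sin b)\<^sup>2"
    by (simp add: dist_norm cmod_power2)
  also have "\<dots> = ((sin a)\<^sup>2 + (cos a)\<^sup>2) + ((sin b)\<^sup>2 + (cos b)\<^sup>2) - 2 * cos (a - b)"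
    unfolding cos_diff by (simp only: power2_eq_square) algebra
  finally show ?thesis
    by simp
qed

lemma dist_cis_le: "dist (cis a) (cis b) \<le> \<bar>a - b\<bar>"
proof (rule power2_le_imp_le)
  have "2 * ((a - b) / 2) = a - b"
    by simp
  then have "2 - 2 * cos (a - b) = 4 * (sin ((a - b) / 2))\<^sup>2"
    using cos_double_sin[of "(a - b) / 2"] by (simp only:) simp
  also have "\<dots> \<le> 4 * ((a - b) / 2)\<^sup>2"
    using abs_le_square_iff[THEN iffD1, OF abs_sin_x_le_abs_x, of "(a - b) / 2"] by simp
  also have "\<dots> = \<bar>a - b\<bar>\<^sup>2"
    by (simp add: power_divide)
  finally show "(dist (cis a) (cis b))\<^sup>2 \<le> \<bar>a - b\<bar>\<^sup>2"
    by (simp add: dist_cis_squared)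
qed simp

text \<open>\<open>sqrt (2 - 2 * cos e)\<close> is the chord of an arc of length \<open>e\<close>,
  and chords grow with the arc up to half a turn.\<close>

lemma dist_cis_less_imp:
  assumes "dist (cis a) (cis b) < sqrt (2 - 2 * cos e)" "\<bar>a - b\<bar> \<le> pi" "0 \<le> e"
  shows "\<bar>a - b\<bar> < e"
proof (rule ccontr)
  assume "\<not> ?thesis"
  then have "cos \<bar>a - b\<bar> \<le> cos e"
    using assms by (intro cos_monotone_0_pi_le) auto
  then have "2 - 2 * cos e \<le> (dist (cis a) (cis b))\<^sup>2"
    by (simp add: dist_cis_squared)
  then have "sqrt (2 - 2 * cos e) \<le> dist (cis a) (cis b)"
    by (rule real_le_lsqrt[rotated 1]) auto
  then show False
    using assms(1) by simp
qed

lemma inv_F2_letter: "inv\<^bsub>F2\<^esub> [l] = [inv_letter l]"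
  by (rule group.inv_equality[OF group_free_group])
     (auto simp: free_group_def mult_word_def reduced_word_def)

lemma S_F2_letter: "s \<in> S_F2 \<Longrightarrow> \<exists>l. s = [l]"
  by (auto simp: S_F2_def a_F2_def b_F2_def inv_F2_letter)

lemma letter_in_F2: "[l] \<in> carrier F2"
  by (simp add: free_group_def reduced_word_def)

text \<open>Freeness lets the generators be lifted independently; the only relations are
  cancellations, so each generator is lifted together with its inverse.\<close>

lemma F2_circle_action_lift:
  assumes "dynamical_system F2 circle \<Phi>"
  obtains F where "line_action F"
    "\<And>g x. reduced_word g \<Longrightarrow> cis (line_action.act F g x) = \<Phi> g (cis x)"
proof -
  have cont: "continuous_on circle (\<Phi> [l])" and image: "\<Phi> [l] \<in> circle \<rightarrow> circle" for l
    using action_continuous[OF assms letter_in_F2] action_image[OF assms letter_in_F2]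
    by (blast, simp add: image_subset_iff_funcset[symmetric])
  have inv: "\<Phi> [inv_letter l] (\<Phi> [l] z) = z" if "z \<in> circle" for l z
    using action_inv[OF assms letter_in_F2 that] by (simp add: inv_F2_letter)
  have inv': "\<Phi> [l] (\<Phi> [inv_letter l] z) = z" if "z \<in> circle" for l z
    using inv[of z "inv_letter l"] that by simp
  define lifts where "lifts c A B \<longleftrightarrow>
      continuous_on UNIV A \<and> (\<forall>x. cis (A x) = \<Phi> [(c, True)] (cis x)) \<and>
      continuous_on UNIV B \<and> (\<forall>x. cis (B x) = \<Phi> [(c, False)] (cis x)) \<and>
      (\<forall>x. A (B x) = x) \<and> (\<forall>x. B (A x) = x)" for c and A B :: "real \<Rightarrow> real"
  have "\<exists>A B. lifts c A B" for c
  proof -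
    have "\<Phi> [(c, True)] (\<Phi> [(c, False)] z) = z" "\<Phi> [(c, False)] (\<Phi> [(c, True)] z) = z"
      if "z \<in> circle" for z
      using inv[OF that, of "(c, True)"] inv'[OF that, of "(c, True)"] by (simp_all add: inv_letter_def)
    then show ?thesis
      using circle_homeomorphism_lift[OF cont[of "(c, True)"] image[of "(c, True)"]
        cont[of "(c, False)"] image[of "(c, False)"], where thesis = "\<exists>A B. lifts c A B"]
      unfolding lifts_def by auto
  qed
  then obtain A B where "\<And>c. lifts c (A c) (B c)"
    by metis
  then have AB: "\<And>c. continuous_on UNIV (A c)" "\<And>c x. cis (A c x) = \<Phi> [(c, True)] (cis x)"
    "\<And>c. continuous_on UNIV (B c)" "\<And>c x. cis (B c x) = \<Phi> [(c, False)] (cis x)"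
    "\<And>c x. A c (B c x) = x" "\<And>c x. B c (A c x) = x"
    unfolding lifts_def by blast+
  define F where "F l = (if snd l then A (fst l) else B (fst l))" for l
  have F_lift: "cis (F l x) = \<Phi> [l] (cis x)" for l x
    using AB(2,4)[of "fst l" x] by (cases l) (auto simp: F_def)
  interpret line_action F
  proof
    show "F l (F (inv_letter l) x) = x" for l x
      using AB(5,6) by (simp add: F_def inv_letter_def)
    show "continuous_on UNIV (F l)" for l
      using AB(1,3) by (simp add: F_def)
    show "cis (F l x) = cis (F l y)" if "cis x = cis y" for l x y
      using that by (simp add: F_lift)
  qed
  have "cis (act g x) = \<Phi> g (cis x)" if "reduced_word g" for g x
    using that
  proof (induction g)
    case Nil
    have "\<Phi> [] z = z" if "z \<in> circle" for z
    proof -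
      let ?l = "(Gen_a, True)"
      have "[?l] \<otimes>\<^bsub>F2\<^esub> [inv_letter ?l] = []"
        by (simp add: free_group_def mult_word_def)
      then show ?thesis
        using action_mult[OF assms letter_in_F2[of ?l] letter_in_F2[of "inv_letter ?l"] that]
          inv'[OF that, of ?l] by simp
    qed
    then show ?case by simp
  next
    case (Cons l g)
    then have g: "g \<in> carrier F2" and red: "reduced_word g"
      by (auto simp: reduced_Cons free_group_def)
    have "\<Phi> [l] (\<Phi> g (cis x)) = \<Phi> (l # g) (cis x)"
      using action_mult[OF assms letter_in_F2 g, of "cis x" l] cons_reduce_reduced[OF Cons.prems]
      by (simp add: free_group_def mult_word_def)
    then show ?case
      using Cons.IH[OF red] by (simp add: F_lift)
  qed
  then show thesis
    using that line_action_axioms by blast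
qed

text \<open>A shadow on the circle fixes the line orbit only modulo \<open>2 * pi\<close>. Starting
  within \<open>pi\<close> of \<open>t []\<close>, induction on the word keeps the distance within
  half a turn, so the orbit never changes sheet.\<close>

lemma (in line_action) circle_shadowing_imp_line_shadowing:
  assumes lift: "\<And>g x. reduced_word g \<Longrightarrow> cis (act g x) = \<Phi> g (cis x)"
    and shadowing: "shadowing_property F2 S_F2 circle \<Phi>"
  shows "line_shadowing"
  unfolding line_shadowing_def
proof (intro allI impI)
  fix \<epsilon> :: real assume "\<epsilon> > 0"
  obtain \<eta> where \<eta>: "\<eta> > 0" "\<And>l x y. \<bar>x - y\<bar> < \<eta> \<Longrightarrow> \<bar>F l x - F l y\<bar> < 1"
    using F_unif_finite[of 1] by auto
  define e where "e = min 1 (min \<epsilon> \<eta>)"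
  have e: "0 < e" "e \<le> 1" "e \<le> \<epsilon>" "e \<le> \<eta>"
    using \<open>\<epsilon> > 0\<close> \<eta>(1) by (auto simp: e_def)
  have "cos e < cos 0"
    using e pi_gt3 by (intro cos_monotone_0_pi) auto
  then have "0 < sqrt (2 - 2 * cos e)"
    by simp
  then obtain \<delta> where \<delta>: "\<delta> > 0" "\<And>x. pseudotrajectory F2 S_F2 circle \<Phi> \<delta> x \<Longrightarrow>
      \<exists>y\<in>circle. \<forall>g\<in>carrier F2. dist (x g) (\<Phi> g y) < sqrt (2 - 2 * cos e)"
    using shadowing unfolding shadowing_property_def by blast
  show "\<exists>\<delta>>0. \<forall>t. line_pseudotrajectory \<delta> t \<longrightarrow>
      (\<exists>y. \<forall>g. reduced_word g \<longrightarrow> \<bar>t g - act g y\<bar> < \<epsilon>)"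
  proof (rule exI[of _ "min \<delta> 1"], intro conjI allI impI)
    fix t assume t: "line_pseudotrajectory (min \<delta> 1) t"
    have t_step: "\<bar>F l (t g) - t (cons_reduce l g)\<bar> < min \<delta> 1" if "reduced_word g" for g l
      using t that unfolding line_pseudotrajectory_def by blast
    have "pseudotrajectory F2 S_F2 circle \<Phi> \<delta> (\<lambda>g. cis (t g))"
      unfolding pseudotrajectory_def
    proof (intro conjI ballI)
      fix g s assume g: "g \<in> carrier F2" and "s \<in> S_F2"
      then obtain l where l: "s = [l]"
        using S_F2_letter by blast
      have "\<Phi> [l] (cis (t g)) = cis (F l (t g))"
        using lift[of "[l]" "t g"] by (simp add: reduced_Cons)
      moreover have "[l] \<otimes>\<^bsub>F2\<^esub> g = cons_reduce l g"
        by (simp add: free_group_def mult_word_def)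
      ultimately show "dist (\<Phi> s (cis (t g))) (cis (t (s \<otimes>\<^bsub>F2\<^esub> g))) < \<delta>"
        using dist_cis_le[of "F l (t g)" "t (cons_reduce l g)"] t_step[of g l] g
        by (simp add: l free_group_def)
    qed simp
    then obtain z where z: "z \<in> circle"
      "\<And>g. reduced_word g \<Longrightarrow> dist (cis (t g)) (\<Phi> g z) < sqrt (2 - 2 * cos e)"
      using \<delta>(2) by (fastforce simp: free_group_def)
    obtain k :: int where k: "t [] - pi \<le> Arg z + 2 * pi * k" "Arg z + 2 * pi * k < t [] - pi + 2 * pi"
      using translate_into_period by blast
    define y where "y = Arg z + 2 * pi * k"
    have "cis y = z"
      using cis_Arg_circle[OF z(1)] by (simp add: y_def)
    \<comment> \<open>A crude bound \<open>pi\<close> improves to \<open>e\<close>. In the induction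
      it comes from two errors below 1, one from continuity and one from the
      pseudotrajectory.\<close>
    have close: "\<bar>t g - act g y\<bar> < e" if "reduced_word g" "\<bar>t g - act g y\<bar> \<le> pi" for g
      using z(2)[OF that(1)] that(2) e(1) lift[OF that(1), of y] \<open>cis y = z\<close>
      by (intro dist_cis_less_imp) auto
    have "\<bar>t g - act g y\<bar> < e" if "reduced_word g" for g
      using that
    proof (induction g)
      case Nil
      show ?case
        using k by (intro close) (auto simp: y_def abs_le_iff)
    next
      case (Cons l g)
      then have g: "reduced_word g"
        by (simp add: reduced_Cons)
      have "\<bar>F l (t g) - F l (act g y)\<bar> < 1"
        using Cons.IH[OF g] e(4) by (intro \<eta>(2)) simp
      moreover have "\<bar>F l (t g) - t (l # g)\<bar> < 1"
        using t_step[OF g, of l] cons_reduce_reduced[OF Cons.prems] by simp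
      ultimately have "\<bar>t (l # g) - act (l # g) y\<bar> \<le> pi"
        using pi_gt3 unfolding act_Cons by linarith
      then show ?case
        by (rule close[OF Cons.prems])
    qed
    then show "\<exists>y. \<forall>g. reduced_word g \<longrightarrow> \<bar>t g - act g y\<bar> < \<epsilon>"
      using e(3) by (meson order.strict_trans2)
  qed (use \<delta> in auto)
qed

theorem theoremA:
  fixes \<Phi> :: "gen word \<Rightarrow> complex \<Rightarrow> complex"
  assumes "dynamical_system F2 circle \<Phi>"
    and "\<exists>M. M \<subseteq> circle \<and> minimal_set F2 circle \<Phi> M \<and> \<not> cantor_set M"
  shows "\<not> shadowing_property F2 S_F2 circle \<Phi>"
proof
  assume shadowing: "shadowing_property F2 S_F2 circle \<Phi>"
  obtain M where M: "M \<subseteq> circle" "minimal_set F2 circle \<Phi> M" "\<not> cantor_set M"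
    using assms(2) by blast
  obtain F where F: "line_action F"
    "\<And>g x. reduced_word g \<Longrightarrow> cis (line_action.act F g x) = \<Phi> g (cis x)"
    using F2_circle_action_lift[OF assms(1)] by blast
  interpret line_action F
    by (rule F(1))
  have carrier: "g \<in> carrier F2 \<longleftrightarrow> reduced_word g" for g
    by (simp add: free_group_def)
  have line: "line_shadowing"
    using circle_shadowing_imp_line_shadowing[OF F(2) shadowing] .
  show False
  proof (cases rule: minimal_set_circle_cases[OF assms(1) M(2)])
    case 1
    have Arg_M: "cis (Arg z) = z" if "z \<in> M" for z
      using that M(1) cis_Arg_circle by blast
    have "\<not> line_shadowing"
    proof (rule finite_orbit_not_shadowing[of "Arg ` M"])
      show "finite (Arg ` M)" "Arg ` M \<noteq> {}"
        using 1 M(2) by (auto simp: minimal_set_def)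
      fix w x assume "x \<in> Arg ` M"
      then have "cis x \<in> M"
        using Arg_M by auto
      obtain v where v: "reduced_word v" "act v = act w"
        using act_reduced_word by blast
      have "cis (act w x) \<in> M"
        using minimal_set_invariant[OF assms(1) M(2), of v "cis x"] \<open>cis x \<in> M\<close> F(2)[OF v(1), of x] v
        by (simp add: carrier)
      then show "cis (act w x) \<in> cis ` Arg ` M"
        using Arg_M by (metis imageI)
    qed
    then show False
      using line by contradiction
  next
    case 2
    have "\<not> line_shadowing"
    proof (rule dense_orbits_not_shadowing)
      fix x a b :: real assume "a < b"
      \<comment> \<open>\<open>cis_image_arc\<close> needs an arc shorter than a full turn.\<close>
      define b' where "b' = min b (a + pi)"
      have b': "a < b'" "b' < a + 2 * pi" "b' \<le> b"
        using \<open>a < b\<close> pi_gt_zero unfolding b'_def by (auto simp: min_less_iff_disj)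
      let ?V = "- cis ` {b'..a + 2 * pi}"
      have "open ?V"
        using compact_cis_image compact_imp_closed by blast
      moreover have arc: "?V \<inter> circle = cis ` {a<..<b'}"
        using cis_image_arc[OF b'(1,2)] by blast
      ultimately obtain g where g: "reduced_word g" "\<Phi> g (cis x) \<in> ?V"
        using minimal_set_dense[OF assms(1) M(2), of "cis x" ?V] 2 b'(1) by (auto simp: carrier)
      have "cis (act g x) \<in> ?V \<inter> circle"
        using g(2) unfolding F(2)[OF g(1), symmetric] by simp
      then obtain r where "a < r" "r < b'" "cis r = cis (act g x)"
        unfolding arc by auto
      then show "\<exists>w. \<exists>k::int. a < act w x + 2 * pi * k \<and> act w x + 2 * pi * k < b"
        using b'(3) unfolding cis_eq_cis_iff by (metis order.strict_trans2)
    qed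
    then show False
      using line by contradiction
  next
    case 3
    then show False
      using M(3) by contradiction
  qed
qed

end
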